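(* Let $n\ge2$ and let $\mathfrak g\cong\mathfrak{sp}(2n,\mathbb C)$ (type $C_n$) be the Lie algebra of complex $2n\times2n$ matrices $$Z=\begin{pmatrix} A & B \\ C & -\tilde A \end{pmatrix},\qquad B=\tilde B,\quad C=\tilde C,$$ with $n\times n$ blocks, where $\tilde X=JX^TJ$. Let $\lambda_n$ be the involution of $\mathfrak g$ given by $$\lambda_n(Z)=\begin{pmatrix} -\tilde A & C \\ B & A \end{pmatrix},$$ and let $\mathfrak g=\mathfrak g_0\oplus\mathfrak g_1$ be its decomposition into $+1$ and $-1$ eigenspaces. Then $$\mathfrak g_0=\Bigl\{\begin{pmatrix} X & Y \\ Y & X \end{pmatrix}:\tilde X=-X,\ \tilde Y=Y\Bigr\},\qquad \mathfrak g_1=\Bigl\{\begin{pmatrix} X & Y \\ -Y & -X \end{pmatrix}:\tilde X=X,\ \tilde Y=Y\Bigr\},$$ and $\mathfrak g_0=\tilde{\mathfrak g}_0\oplus V$, where $\tilde{\mathfrak g}_0$ is the part of $\mathfrak g_0$ with $Y=0$ and $V$ the part with $X=0$. Moreover $\tilde{\mathfrak g}_0\cong\mathfrak{so}(n,\mathbb C)$, $\mathfrak g_0\cong\mathfrak{gl}(n,\mathbb C)$, and $$\dim\tilde{\mathfrak g}_0=\tfrac12n(n-1),\quad\dim V=\tfrac12n(n+1),\quad\dim\mathfrak g_1=n(n+1).$$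
   Context: $J$ is the $n\times n$ anti-diagonal matrix with all anti-diagonal entries equal to $1$. *)

theory Defs
  imports Complex_Main "Jordan_Normal_Form.VS_Connect"
begin

section \<open>Lie algebras of complex matrices\<close>

text \<open>Matrices are those of \<^typ>\<open>complex mat\<close>, whose size is part of the value; the size
  \<open>N\<close> of the ambient matrix space is therefore an argument below. The scalar field is
  \<^term>\<open>class_ring :: complex ring\<close>.\<close>

definition mat_vs :: "nat \<Rightarrow> complex mat set \<Rightarrow> (complex, complex mat) module" where
  "mat_vs N L = (module_mat TYPE(complex) N N)\<lparr>carrier := L\<rparr>"

definition mat_subspace :: "nat \<Rightarrow> complex mat set \<Rightarrow> bool" where
  "mat_subspace N L \<longleftrightarrow> VectorSpace.subspace class_ring L (module_mat TYPE(complex) N N)"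

definition mat_dim :: "nat \<Rightarrow> complex mat set \<Rightarrow> nat" where
  "mat_dim N L = vectorspace.dim class_ring (mat_vs N L)"

definition mat_direct_sum :: "nat \<Rightarrow> complex mat set \<Rightarrow> complex mat set \<Rightarrow> complex mat set \<Rightarrow> bool" where
  "mat_direct_sum N L L1 L2 \<longleftrightarrow>
     mat_subspace N L1 \<and> mat_subspace N L2 \<and>
     L = {X + Y | X Y. X \<in> L1 \<and> Y \<in> L2} \<and> L1 \<inter> L2 = {0\<^sub>m N N}"

definition lie_bracket :: "complex mat \<Rightarrow> complex mat \<Rightarrow> complex mat" where
  "lie_bracket X Y = X * Y - Y * X"

definition lie_subalgebra :: "nat \<Rightarrow> complex mat set \<Rightarrow> bool" where
  "lie_subalgebra N L \<longleftrightarrow>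
     mat_subspace N L \<and> (\<forall>X\<in>L. \<forall>Y\<in>L. lie_bracket X Y \<in> L)"

definition lie_iso ::
  "nat \<Rightarrow> complex mat set \<Rightarrow> nat \<Rightarrow> complex mat set \<Rightarrow> (complex mat \<Rightarrow> complex mat) \<Rightarrow> bool" where
  "lie_iso N L M K f \<longleftrightarrow>
     lie_subalgebra N L \<and> lie_subalgebra M K \<and>
     linear_map class_ring (mat_vs N L) (mat_vs M K) f \<and> bij_betw f L K \<and>
     (\<forall>X\<in>L. \<forall>Y\<in>L. f (lie_bracket X Y) = lie_bracket (f X) (f Y))"

definition lie_isomorphic :: "nat \<Rightarrow> complex mat set \<Rightarrow> nat \<Rightarrow> complex mat set \<Rightarrow> bool" where
  "lie_isomorphic N L M K \<longleftrightarrow> (\<exists>f. lie_iso N L M K f)"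

section \<open>The classical Lie algebras\<close>

definition gl :: "nat \<Rightarrow> complex mat set" where
  "gl n = carrier_mat n n"

definition so :: "nat \<Rightarrow> complex mat set" where
  "so n = {X \<in> carrier_mat n n. X\<^sup>T = - X}"

text \<open>The argument of \<open>sp\<close> is the rank \<open>n\<close>: this is \<open>sp(2n)\<close>, with respect to the
  standard symplectic form.\<close>

definition symp_form :: "nat \<Rightarrow> complex mat" where
  "symp_form n = four_block_mat (0\<^sub>m n n) (1\<^sub>m n) (- 1\<^sub>m n) (0\<^sub>m n n)"

definition sp :: "nat \<Rightarrow> complex mat set" where
  "sp n = {Z \<in> carrier_mat (2 * n) (2 * n).
     Z\<^sup>T * symp_form n + symp_form n * Z = 0\<^sub>m (2 * n) (2 * n)}"

section \<open>The algebra \<open>\<gg>\<close>, the involution and its eigenspaces\<close>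

text \<open>Indices start at 0, so the anti-diagonal is given by \<open>i + j + 1 = n\<close>.\<close>

definition J_mat :: "nat \<Rightarrow> complex mat" where
  "J_mat n = mat n n (\<lambda>(i, j). if i + j + 1 = n then 1 else 0)"

definition tilde :: "nat \<Rightarrow> complex mat \<Rightarrow> complex mat" where
  "tilde n X = J_mat n * X\<^sup>T * J_mat n"

definition g_alg :: "nat \<Rightarrow> complex mat set" where
  "g_alg n = {four_block_mat A B C (- tilde n A) | A B C.
     A \<in> carrier_mat n n \<and> B \<in> carrier_mat n n \<and> C \<in> carrier_mat n n \<and>
     B = tilde n B \<and> C = tilde n C}"

definition lam :: "nat \<Rightarrow> complex mat \<Rightarrow> complex mat" where
  "lam n Z = (case split_block Z n n of (A, B, C, D) \<Rightarrow> four_block_mat (- tilde n A) C B A)"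

definition g0 :: "nat \<Rightarrow> complex mat set" where
  "g0 n = {Z \<in> g_alg n. lam n Z = Z}"

definition g1 :: "nat \<Rightarrow> complex mat set" where
  "g1 n = {Z \<in> g_alg n. lam n Z = - Z}"

definition g0_tilde :: "nat \<Rightarrow> complex mat set" where
  "g0_tilde n = {Z \<in> g0 n.
     \<exists>X \<in> carrier_mat n n. Z = four_block_mat X (0\<^sub>m n n) (0\<^sub>m n n) X}"

definition V_part :: "nat \<Rightarrow> complex mat set" where
  "V_part n = {Z \<in> g0 n.
     \<exists>Y \<in> carrier_mat n n. Z = four_block_mat (0\<^sub>m n n) Y Y (0\<^sub>m n n)}"

end

theory Submission
  imports Defs
begin

text \<open>\<open>tilde\<close> is the reflection of a matrix in its anti-diagonal, and \<open>J\<^sup>2 = 1\<close>. Conjugation by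
  \<open>diag(1, J)\<close> turns the conditions defining \<open>\<gg>\<close> into those defining \<open>sp\<close>, and \<open>lam\<close> is
  conjugation by the matrix that swaps the two halves of the coordinates, hence an automorphism.
  The block matrices \<open>(X, Y; Y, X)\<close> multiply like \<open>X + \<epsilon>Y\<close> with \<open>\<epsilon>\<^sup>2 = 1\<close>, so that \<open>\<epsilon> = 1\<close> gives a
  homomorphism \<open>X + Y\<close> from \<open>g0\<close> to \<open>gl\<close>; it is bijective because every matrix splits uniquely
  into a \<open>tilde\<close>-skew and a \<open>tilde\<close>-symmetric part. As \<open>J\<close> has a symmetric square root \<open>P\<close>,
  \<open>X \<mapsto> P X P\<^sup>-\<^sup>1\<close> takes \<open>tilde\<close>-skew matrices to skew-symmetric ones.\<close>

section \<open>Subspaces of matrices and Lie isomorphisms\<close>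

lemma mat_vs_simps:
  "carrier (mat_vs N L) = L" "add (mat_vs N L) = (+)" "module.smult (mat_vs N L) = (\<cdot>\<^sub>m)"
  "zero (mat_vs N L) = 0\<^sub>m N N"
  by (simp_all add: mat_vs_def module_mat_simps)

lemma mat_subspace_iff:
  "mat_subspace N L \<longleftrightarrow>
     L \<subseteq> carrier_mat N N \<and> 0\<^sub>m N N \<in> L \<and> (\<forall>X\<in>L. \<forall>Y\<in>L. X + Y \<in> L) \<and> (\<forall>c. \<forall>X\<in>L. c \<cdot>\<^sub>m X \<in> L)"
  using matrix_vs[of N N, where 'a = complex]
  unfolding mat_subspace_def subspace_def submodule_def vectorspace_def
  by (simp add: module_mat_simps) blast

lemma mat_vs_vectorspace:
  assumes "mat_subspace N L"
  shows "vectorspace class_ring (mat_vs N L)"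
  using vectorspace.subspace_is_vs[OF matrix_vs] assms unfolding mat_vs_def mat_subspace_def by blast

text \<open>Addition and scaling act entrywise, so an entry of a linear combination is a sum of
  scalars. This is how coefficients are read off when a basis is checked.\<close>

lemma lincomb_index:
  assumes L: "mat_subspace N L" and "finite B" "B \<subseteq> L" and ij: "i < N" "j < N"
  shows "module.lincomb (mat_vs N L) a B $$ (i, j) = (\<Sum>v\<in>B. a v * v $$ (i, j))"
  using \<open>finite B\<close> \<open>B \<subseteq> L\<close>
proof (induction B)
  interpret vectorspace class_ring "mat_vs N L"
    by (rule mat_vs_vectorspace[OF L])
  case empty
  then show ?case using ij by (simp add: lincomb_def mat_vs_simps)
next
  interpret vectorspace class_ring "mat_vs N L"
    by (rule mat_vs_vectorspace[OF L])
  case (insert v B)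
  have sub: "L \<subseteq> carrier_mat N N" using L by (simp add: mat_subspace_iff)
  have "lincomb a B \<in> carrier (mat_vs N L)"
    using insert.prems by (intro lincomb_closed) (auto simp: mat_vs_simps)
  then have "lincomb a B \<in> carrier_mat N N" "v \<in> carrier_mat N N"
    using sub insert.prems by (auto simp: mat_vs_simps)
  moreover have "lincomb a (insert v B) = a v \<cdot>\<^sub>m v + lincomb a B"
    using insert lincomb_insert2[of B a v] by (simp add: mat_vs_simps)
  ultimately show ?case using insert ij by simp
qed

text \<open>A subspace whose elements are determined by their entries at the positions in \<open>I\<close>, where
  these entries may be prescribed freely, has the matrices with a single entry \<open>1\<close> on \<open>I\<close> as basis.\<close>

lemma mat_dim_eq_card_entries:
  assumes L: "mat_subspace N L" and I: "I \<subseteq> {..<N} \<times> {..<N}"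
    and determined: "\<And>X Y. X \<in> L \<Longrightarrow> Y \<in> L \<Longrightarrow> (\<And>p. p \<in> I \<Longrightarrow> X $$ p = Y $$ p) \<Longrightarrow> X = Y"
    and free: "\<And>f. \<exists>X\<in>L. \<forall>p\<in>I. X $$ p = f p"
  shows "mat_dim N L = card I"
proof -
  interpret vectorspace class_ring "mat_vs N L"
    by (rule mat_vs_vectorspace[OF L])
  have finI: "finite I" using I by (rule finite_subset) simp
  \<comment> \<open>For \<open>p\<close> in \<open>I\<close> this is a system dual to the entry
    functionals on \<open>I\<close>; the entries of \<open>e p\<close> outside \<open>I\<close> are
    whatever \<open>L\<close> forces.\<close>
  have "\<exists>e. \<forall>p. e p \<in> L \<and> (\<forall>q\<in>I. e p $$ q = (if q = p then 1 else 0))"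
  proof (intro choice allI)
    fix p
    from free[of "\<lambda>q. if q = p then 1 else 0"]
    show "\<exists>X. X \<in> L \<and> (\<forall>q\<in>I. X $$ q = (if q = p then 1 else 0))" by blast
  qed
  then obtain e where eL: "\<And>p. e p \<in> L"
    and e: "\<And>p q. q \<in> I \<Longrightarrow> e p $$ q = (if q = p then 1 else 0)"
    by blast
  have inj: "inj_on e I"
    by (rule inj_onI) (metis e zero_neq_one)
  \<comment> \<open>By duality, the entry at \<open>p\<close> of a combination of the
    \<open>e q\<close> is the coefficient of \<open>e p\<close>. This gives both independence and
    spanning.\<close>
  have entry: "lincomb a (e ` I) $$ p = a (e p)" if "p \<in> I" for a p
  proof -
    obtain i j where p: "p = (i, j)" "i < N" "j < N" using I \<open>p \<in> I\<close> by auto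
    have "lincomb a (e ` I) $$ p = (\<Sum>q\<in>I. a (e q) * e q $$ p)"
      using lincomb_index[OF L, of "e ` I" i j a] finI eL p inj by (simp add: image_subset_iff sum.reindex)
    also have "\<dots> = (\<Sum>q\<in>I. if q = p then a (e q) else 0)"
      by (rule sum.cong) (auto simp: e that)
    finally show ?thesis using that finI by simp
  qed
  have "basis (e ` I)"
    unfolding basis_def
  proof (intro conjI)
    show sub: "e ` I \<subseteq> carrier (mat_vs N L)" using eL by (auto simp: mat_vs_simps)
    show "lin_indpt (e ` I)"
    proof (rule finite_lin_indpt2)
      fix a :: "complex mat \<Rightarrow> complex"
      assume *: "lincomb a (e ` I) = \<zero>\<^bsub>mat_vs N L\<^esub>"
      have "a (e p) = 0" if "p \<in> I" for p
        using entry[OF that, of a] * I that by (auto simp: mat_vs_simps)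
      then show "\<forall>v\<in>e ` I. a v = \<zero>\<^bsub>class_ring\<^esub>" by auto
    qed (use finI sub in auto)
    show "span (e ` I) = carrier (mat_vs N L)"
    proof
      show "span (e ` I) \<subseteq> carrier (mat_vs N L)"
        by (rule span_is_subset2[OF sub])
      show "carrier (mat_vs N L) \<subseteq> span (e ` I)"
      proof
        fix X assume "X \<in> carrier (mat_vs N L)"
        then have X: "X \<in> L" by (simp add: mat_vs_simps)
        \<comment> \<open>A basis vector gets as coefficient the entry of \<open>X\<close> at its
          own position, which the inverse of \<open>e\<close> on \<open>I\<close> recovers.\<close>
        define a where "a v = X $$ the_inv_into I e v" for v
        have "lincomb a (e ` I) \<in> L"
          using sub lincomb_closed[of "e ` I" a] by (simp add: mat_vs_simps)
        then have "X = lincomb a (e ` I)"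
          by (intro determined[OF X]) (simp_all add: entry a_def the_inv_into_f_f[OF inj])
        then show "X \<in> span (e ` I)"
          unfolding span_def using finI by auto
      qed
    qed
  qed
  then have "dim = card (e ` I)" using finI by (intro dim_basis) auto
  then show ?thesis by (simp add: mat_dim_def card_image[OF inj])
qed

section \<open>Transport of Lie algebra structure along a bijection\<close>

text \<open>The structure of \<open>K\<close> is carried over from \<open>L\<close>: closure of
  \<open>K\<close> under the operations is a conclusion here, and compatibility is checked for
  \<open>f\<close> alone, while that of \<open>g\<close> follows.\<close>

lemma lie_iso_transport:
  assumes L: "lie_subalgebra N L" and K: "K \<subseteq> carrier_mat M M"
    and f: "\<And>X. X \<in> L \<Longrightarrow> f X \<in> K" and g: "\<And>Y. Y \<in> K \<Longrightarrow> g Y \<in> L"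
    and gf: "\<And>X. X \<in> L \<Longrightarrow> g (f X) = X" and fg: "\<And>Y. Y \<in> K \<Longrightarrow> f (g Y) = Y"
    and add: "\<And>X Y. X \<in> L \<Longrightarrow> Y \<in> L \<Longrightarrow> f (X + Y) = f X + f Y"
    and smult: "\<And>c X. X \<in> L \<Longrightarrow> f (c \<cdot>\<^sub>m X) = c \<cdot>\<^sub>m f X"
    and bracket: "\<And>X Y. X \<in> L \<Longrightarrow> Y \<in> L \<Longrightarrow> f (lie_bracket X Y) = lie_bracket (f X) (f Y)"
  shows "lie_iso N L M K f" and "lie_iso M K N L g"
proof -
  have subL: "mat_subspace N L" and brL: "\<And>X Y. X \<in> L \<Longrightarrow> Y \<in> L \<Longrightarrow> lie_bracket X Y \<in> L"
    using L by (auto simp: lie_subalgebra_def)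
  note clL = subL[unfolded mat_subspace_iff]
  \<comment> \<open>Each operation on \<open>K\<close> is the image under \<open>f\<close> of the
    operation in \<open>L\<close>; closure of \<open>K\<close> and the laws for \<open>g\<close>
    rest on these three equations.\<close>
  have add': "X + Y = f (g X + g Y)" if "X \<in> K" "Y \<in> K" for X Y
    using that by (simp add: add fg g)
  have smult': "c \<cdot>\<^sub>m X = f (c \<cdot>\<^sub>m g X)" if "X \<in> K" for c X
    using that by (simp add: smult fg g)
  have bracket': "lie_bracket X Y = f (lie_bracket (g X) (g Y))" if "X \<in> K" "Y \<in> K" for X Y
    using that by (simp add: bracket fg g)
  have zL: "0\<^sub>m N N \<in> L" using clL by blast
  have "f (0\<^sub>m N N) \<in> carrier_mat M M" using f[OF zL] K by blast
  \<comment> \<open>Zero is its own multiple by the scalar 0, so compatibility with scaling already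
    forces \<open>f\<close> to preserve it.\<close>
  then have "f (0 \<cdot>\<^sub>m 0\<^sub>m N N) = 0\<^sub>m M M"
    unfolding smult[OF zL] by auto
  then have zero: "f (0\<^sub>m N N) = 0\<^sub>m M M"
    by simp
  have subK: "mat_subspace M K"
    unfolding mat_subspace_iff
  proof (intro conjI ballI allI)
    show "0\<^sub>m M M \<in> K" using f[OF zL] zero by simp
    show "X + Y \<in> K" if "X \<in> K" "Y \<in> K" for X Y
      using that g clL f add' by metis
    show "c \<cdot>\<^sub>m X \<in> K" if "X \<in> K" for c X
      using that g clL f smult' by metis
  qed (rule K)
  have KK: "lie_subalgebra M K"
    unfolding lie_subalgebra_def using subK bracket' brL f g by auto
  have bijf: "bij_betw f L K" by (rule bij_betw_byWitness[of _ g]) (use f g gf fg in auto)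
  have bijg: "bij_betw g K L" by (rule bij_betw_byWitness[of _ f]) (use f g gf fg in auto)
  have homf: "linear_map class_ring (mat_vs N L) (mat_vs M K) f"
    using mat_vs_vectorspace[OF subL] mat_vs_vectorspace[OF subK]
    unfolding linear_map_def mod_hom_def mod_hom_axioms_def vectorspace_def LinearCombinations.module_hom_def
    by (auto simp: mat_vs_simps f add smult)
  have "g (X + Y) = g X + g Y" if "X \<in> K" "Y \<in> K" for X Y
    using that add' gf g clL by metis
  moreover have "g (c \<cdot>\<^sub>m X) = c \<cdot>\<^sub>m g X" if "X \<in> K" for c X
    using that smult' gf g clL by metis
  ultimately have homg: "linear_map class_ring (mat_vs M K) (mat_vs N L) g"
    using mat_vs_vectorspace[OF subL] mat_vs_vectorspace[OF subK]
    unfolding linear_map_def mod_hom_def mod_hom_axioms_def vectorspace_def LinearCombinations.module_hom_def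
    by (auto simp: mat_vs_simps g)
  show "lie_iso N L M K f" 
    unfolding lie_iso_def using L KK homf bijf bracket by blast
  have "g (lie_bracket X Y) = lie_bracket (g X) (g Y)" if "X \<in> K" "Y \<in> K" for X Y
    using that bracket' gf g brL by metis
  then show "lie_iso M K N L g" 
    unfolding lie_iso_def using L KK homg bijg by blast
qed

lemma lie_bracket_carrier:
  "X \<in> carrier_mat N N \<Longrightarrow> Y \<in> carrier_mat N N \<Longrightarrow> lie_bracket X Y \<in> carrier_mat N N"
  unfolding lie_bracket_def by (intro minus_carrier_mat mult_carrier_mat[of _ N N])

lemma add_eq_zero_mat_iff:
  fixes A B :: "'a :: ab_group_add mat"
  assumes "A \<in> carrier_mat nr nc" "B \<in> carrier_mat nr nc"
  shows "A + B = 0\<^sub>m nr nc \<longleftrightarrow> A = - B"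
  using assms by (auto simp: mat_eq_iff add_eq_0_iff2)

text \<open>These are the matrices that are skew for the bilinear form \<open>F\<close>. The
  symplectic form gives \<open>sp\<close> and the identity matrix gives \<open>so\<close>, so both
  algebras are covered at once.\<close>

lemma form_algebra_lie_subalgebra:
  fixes F :: "complex mat"
  assumes F: "F \<in> carrier_mat N N"
  shows "lie_subalgebra N {Z \<in> carrier_mat N N. Z\<^sup>T * F + F * Z = 0\<^sub>m N N}" (is "lie_subalgebra N ?L")
proof -
  have iff: "Z \<in> ?L \<longleftrightarrow> Z \<in> carrier_mat N N \<and> Z\<^sup>T * F = - (F * Z)" for Z
    using F by (auto simp: add_eq_zero_mat_iff[of _ N N])
  have sub: "mat_subspace N ?L"
    unfolding mat_subspace_iff
  proof (intro conjI ballI allI)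
    show "0\<^sub>m N N \<in> ?L" using F by simp
    show "X + Y \<in> ?L" if "X \<in> ?L" "Y \<in> ?L" for X Y
    proof -
      have "(X + Y)\<^sup>T * F = X\<^sup>T * F + Y\<^sup>T * F"
        using that F by (simp add: transpose_add[of _ N N] add_mult_distrib_mat[of _ N N])
      also have "\<dots> = - (F * (X + Y))"
        using that F unfolding iff by (auto simp: mult_add_distrib_mat[of _ N N])
      finally show ?thesis using that unfolding iff by simp
    qed
    show "c \<cdot>\<^sub>m X \<in> ?L" if "X \<in> ?L" for c X
    proof -
      have "(c \<cdot>\<^sub>m X)\<^sup>T = c \<cdot>\<^sub>m X\<^sup>T" by auto
      then have "(c \<cdot>\<^sub>m X)\<^sup>T * F = c \<cdot>\<^sub>m (X\<^sup>T * F)"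
        using that F by (simp add: mult_smult_assoc_mat[of _ N N])
      also have "\<dots> = - (F * (c \<cdot>\<^sub>m X))"
        using that F unfolding iff by (auto simp: mult_smult_distrib[of _ N N])
      finally show ?thesis using that unfolding iff by simp
    qed
  qed auto
  moreover have "lie_bracket X Y \<in> ?L" if "X \<in> ?L" "Y \<in> ?L" for X Y
  proof -
    have c: "X \<in> carrier_mat N N" "Y \<in> carrier_mat N N" "X\<^sup>T \<in> carrier_mat N N" "Y\<^sup>T \<in> carrier_mat N N"
      and X: "X\<^sup>T * F = - (F * X)" and Y: "Y\<^sup>T * F = - (F * Y)"
      using that unfolding iff by auto
    \<comment> \<open>Moving \<open>F\<close> to the left past one transpose and then the other
      brings in a sign each time, and the two signs cancel.\<close>
    have swap: "B\<^sup>T * A\<^sup>T * F = F * B * A"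
      if "A \<in> carrier_mat N N" "B \<in> carrier_mat N N" "A\<^sup>T * F = - (F * A)" "B\<^sup>T * F = - (F * B)" for A B
    proof -
      have "B\<^sup>T * A\<^sup>T * F = B\<^sup>T * (A\<^sup>T * F)"
        using that F by (intro assoc_mult_mat[of _ N N]) auto
      also have "\<dots> = - (B\<^sup>T * (F * A))"
        using that F by simp
      also have "B\<^sup>T * (F * A) = B\<^sup>T * F * A"
        using that F by (intro assoc_mult_mat[symmetric, of _ N N]) auto
      also have "- (B\<^sup>T * F * A) = F * B * A"
        using that F by simp
      finally show ?thesis .
    qed
    have "(lie_bracket X Y)\<^sup>T * F = Y\<^sup>T * X\<^sup>T * F - X\<^sup>T * Y\<^sup>T * F"
      unfolding lie_bracket_def
      using c F by (simp add: transpose_minus[of _ N N] transpose_mult[of _ N N] minus_mult_distrib_mat[of _ N N])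
    also have "\<dots> = F * Y * X - F * X * Y"
      using swap c X Y by simp
    also have "\<dots> = - (F * X * Y - F * Y * X)"
      using c F by (intro eq_matI) (auto simp del: index_mult_mat(1))
    also have "F * X * Y - F * Y * X = F * lie_bracket X Y"
      unfolding lie_bracket_def using c F
      by (simp add: mult_minus_distrib_mat[of F N N _ N] assoc_mult_mat[of F N N _ N _ N])
    finally show ?thesis using lie_bracket_carrier[OF c(1,2)] unfolding iff by simp
  qed
  ultimately show ?thesis by (simp add: lie_subalgebra_def)
qed

section \<open>Reflection in the anti-diagonal and block matrices\<close>

lemma J_mat_carrier[simp]: "J_mat n \<in> carrier_mat n n"
  and J_mat_dim[simp]: "dim_row (J_mat n) = n" "dim_col (J_mat n) = n"
  by (simp_all add: J_mat_def)

text \<open>Row \<open>i\<close> of \<open>J\<close> has its only 1 in column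
  \<open>n - 1 - i\<close>, so multiplication from the left reverses the rows. Multiplication from
  the right reverses the columns in the same way.\<close>

lemma J_mult_eq:
  assumes "dim_row X = n"
  shows "J_mat n * X = mat n (dim_col X) (\<lambda>(i, j). X $$ (n - 1 - i, j))"
proof (rule eq_matI)
  fix i j assume "i < dim_row (mat n (dim_col X) (\<lambda>(i, j). X $$ (n - 1 - i, j)))"
    "j < dim_col (mat n (dim_col X) (\<lambda>(i, j). X $$ (n - 1 - i, j)))"
  then have ij: "i < n" "j < dim_col X" by simp_all
  then have "(J_mat n * X) $$ (i, j) = (\<Sum>k = 0..<n. (if Suc (i + k) = n then 1 else 0) * X $$ (k, j))"
    using assms by (simp add: J_mat_def scalar_prod_def)
  also have "\<dots> = (\<Sum>k = 0..<n. if k = n - 1 - i then X $$ (k, j) else 0)"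
    by (rule sum.cong) (use ij in auto)
  finally show "(J_mat n * X) $$ (i, j) = mat n (dim_col X) (\<lambda>(i, j). X $$ (n - 1 - i, j)) $$ (i, j)"
    using ij by simp
qed (simp_all add: assms)

lemma mult_J_eq:
  assumes "dim_col X = n"
  shows "X * J_mat n = mat (dim_row X) n (\<lambda>(i, j). X $$ (i, n - 1 - j))"
proof (rule eq_matI)
  fix i j assume "i < dim_row (mat (dim_row X) n (\<lambda>(i, j). X $$ (i, n - 1 - j)))"
    "j < dim_col (mat (dim_row X) n (\<lambda>(i, j). X $$ (i, n - 1 - j)))"
  then have ij: "i < dim_row X" "j < n" by simp_all
  then have "(X * J_mat n) $$ (i, j) = (\<Sum>k = 0..<n. X $$ (i, k) * (if Suc (k + j) = n then 1 else 0))"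
    using assms by (simp add: J_mat_def scalar_prod_def)
  also have "\<dots> = (\<Sum>k = 0..<n. if k = n - 1 - j then X $$ (i, k) else 0)"
    by (rule sum.cong) (use ij in auto)
  finally show "(X * J_mat n) $$ (i, j) = mat (dim_row X) n (\<lambda>(i, j). X $$ (i, n - 1 - j)) $$ (i, j)"
    using ij by simp
qed (simp_all add: assms)

lemma J_mult_index:
  "dim_row X = n \<Longrightarrow> i < n \<Longrightarrow> j < dim_col X \<Longrightarrow> (J_mat n * X) $$ (i, j) = X $$ (n - 1 - i, j)"
  by (simp add: J_mult_eq)

lemma mult_J_index:
  "dim_col X = n \<Longrightarrow> i < dim_row X \<Longrightarrow> j < n \<Longrightarrow> (X * J_mat n) $$ (i, j) = X $$ (i, n - 1 - j)"
  by (simp add: mult_J_eq)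

lemma J_mult_J[simp]: "J_mat n * J_mat n = 1\<^sub>m n"
  by (subst J_mult_eq, simp) (rule eq_matI, auto simp: J_mat_def)

lemma transpose_J[simp]: "(J_mat n)\<^sup>T = J_mat n"
  by (rule eq_matI) (auto simp: J_mat_def)

lemma tilde_dim[simp]: "dim_row (tilde n X) = n" "dim_col (tilde n X) = n"
  unfolding tilde_def by simp_all

lemma tilde_carrier[simp]: "tilde n X \<in> carrier_mat n n"
  by (rule carrier_matI) simp_all

text \<open>Transposing and then reversing rows and columns is the reflection in the anti-diagonal.
  With this form, identities for \<open>tilde\<close> can be verified entry by entry.\<close>

lemma tilde_eq:
  assumes "X \<in> carrier_mat n n"
  shows "tilde n X = mat n n (\<lambda>(i, j). X $$ (n - 1 - j, n - 1 - i))"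
proof -
  have "J_mat n * X\<^sup>T = mat n n (\<lambda>(i, j). X $$ (j, n - 1 - i))"
    using assms by (subst J_mult_eq, simp) (rule eq_matI, auto)
  then show ?thesis
    unfolding tilde_def by (subst mult_J_eq, simp) (rule eq_matI, auto)
qed

lemma tilde_index[simp]:
  assumes "X \<in> carrier_mat n n" "i < n" "j < n"
  shows "tilde n X $$ (i, j) = X $$ (n - 1 - j, n - 1 - i)"
  using assms by (simp add: tilde_eq)

lemma tilde_tilde[simp]: "X \<in> carrier_mat n n \<Longrightarrow> tilde n (tilde n X) = X"
  by (rule eq_matI) auto

lemma tilde_add: "X \<in> carrier_mat n n \<Longrightarrow> Y \<in> carrier_mat n n \<Longrightarrow> tilde n (X + Y) = tilde n X + tilde n Y"
  by (rule eq_matI) auto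

lemma tilde_smult: "X \<in> carrier_mat n n \<Longrightarrow> tilde n (c \<cdot>\<^sub>m X) = c \<cdot>\<^sub>m tilde n X"
  by (rule eq_matI) auto

lemma tilde_uminus: "X \<in> carrier_mat n n \<Longrightarrow> tilde n (- X) = - tilde n X"
  by (rule eq_matI) auto

lemma tilde_zero[simp]: "tilde n (0\<^sub>m n n) = 0\<^sub>m n n"
  by (rule eq_matI) auto

text \<open>Two factors \<open>J\<close> cancel. For symmetric \<open>X\<close> this makes
  \<open>X * J\<close> fixed under \<open>tilde\<close>, as the passage from \<open>sp\<close> to
  \<open>g_alg\<close> requires.\<close>

lemma tilde_mult_J: "X \<in> carrier_mat n n \<Longrightarrow> tilde n (X * J_mat n) = X\<^sup>T * J_mat n"
  by (rule eq_matI) (auto simp: mult_J_index J_mult_index simp del: index_mult_mat(1))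

lemma tilde_J_mult:
  assumes "X \<in> carrier_mat n n"
  shows "tilde n (J_mat n * X) = J_mat n * X\<^sup>T"
proof -
  have "tilde n (J_mat n * X) = J_mat n * (X\<^sup>T * J_mat n) * J_mat n"
    unfolding tilde_def using assms by (simp add: transpose_mult[of _ n n])
  also have "\<dots> = J_mat n * X\<^sup>T"
    using assms by (simp add: assoc_mult_mat[of _ n n _ n _ n])
  finally show ?thesis .
qed

lemma J_conj_J: "X \<in> carrier_mat n n \<Longrightarrow> J_mat n * (J_mat n * X * J_mat n) * J_mat n = X"
  by (rule eq_matI)
     (auto simp: mult_J_index J_mult_index simp del: index_mult_mat(1))

section \<open>Decomposition into blocks\<close>

lemma carrier_mat_four_block_cases:
  assumes "Z \<in> carrier_mat (2 * n) (2 * n)"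
  obtains A B C D where "A \<in> carrier_mat n n" "B \<in> carrier_mat n n" "C \<in> carrier_mat n n"
    "D \<in> carrier_mat n n" "Z = four_block_mat A B C D"
proof -
  obtain A B C D where *: "split_block Z n n = (A, B, C, D)"
    by (cases "split_block Z n n")
  have "dim_row Z = n + n" "dim_col Z = n + n" using assms by auto
  from split_block[OF * this] show ?thesis by (rule that)
qed

lemma split_block_four_block:
  assumes "A \<in> carrier_mat n n" "B \<in> carrier_mat n n" "C \<in> carrier_mat n n" "D \<in> carrier_mat n n"
  shows "split_block (four_block_mat A B C D) n n = (A, B, C, D)"
proof -
  have "mat n n (\<lambda>ij. four_block_mat A B C D $$ ij) = A"
    "mat n n (\<lambda>(i, j). four_block_mat A B C D $$ (i, j + n)) = B"
    "mat n n (\<lambda>(i, j). four_block_mat A B C D $$ (i + n, j)) = C"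
    "mat n n (\<lambda>(i, j). four_block_mat A B C D $$ (i + n, j + n)) = D"
    using assms by (auto intro!: eq_matI)
  then show ?thesis
    using assms by (simp add: split_block_def)
qed

lemma four_block_mat_eq_iff:
  assumes "A \<in> carrier_mat n n" "B \<in> carrier_mat n n" "C \<in> carrier_mat n n" "D \<in> carrier_mat n n"
    "A' \<in> carrier_mat n n" "B' \<in> carrier_mat n n" "C' \<in> carrier_mat n n" "D' \<in> carrier_mat n n"
  shows "four_block_mat A B C D = four_block_mat A' B' C' D' \<longleftrightarrow> A = A' \<and> B = B' \<and> C = C' \<and> D = D'"
proof
  assume "four_block_mat A B C D = four_block_mat A' B' C' D'"
  then have "(A, B, C, D) = (A', B', C', D')"
    unfolding split_block_four_block[OF assms(1-4), symmetric]
      split_block_four_block[OF assms(5-8), symmetric] by (rule arg_cong)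
  then show "A = A' \<and> B = B' \<and> C = C' \<and> D = D'" by simp
qed simp

lemma four_block_mat_carrier_double:
  "A \<in> carrier_mat n n \<Longrightarrow> D \<in> carrier_mat n n \<Longrightarrow> four_block_mat A B C D \<in> carrier_mat (2 * n) (2 * n)"
  by (simp add: mult_2)

lemma uminus_four_block_mat:
  assumes "A \<in> carrier_mat n n" "B \<in> carrier_mat n n" "C \<in> carrier_mat n n" "D \<in> carrier_mat n n"
  shows "- four_block_mat A B C D = four_block_mat (- A) (- B) (- C) (- D)"
  using assms by (intro eq_matI) auto

lemma minus_four_block_mat:
  assumes "A \<in> carrier_mat n n" "B \<in> carrier_mat n n" "C \<in> carrier_mat n n" "D \<in> carrier_mat n n"
    "A' \<in> carrier_mat n n" "B' \<in> carrier_mat n n" "C' \<in> carrier_mat n n" "D' \<in> carrier_mat n n"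
  shows "four_block_mat A B C D - four_block_mat A' B' C' D'
    = four_block_mat (A - A') (B - B') (C - C') (D - D')"
  using assms by (intro eq_matI) auto

lemma zero_eq_four_block_mat: "0\<^sub>m (2 * n) (2 * n) = four_block_mat (0\<^sub>m n n) (0\<^sub>m n n) (0\<^sub>m n n) (0\<^sub>m n n)"
  by (simp add: mult_2)

section \<open>The involution, \<open>g_alg\<close> and \<open>sp\<close> in terms of blocks\<close>

lemma lam_four_block:
  assumes "A \<in> carrier_mat n n" "B \<in> carrier_mat n n" "C \<in> carrier_mat n n" "D \<in> carrier_mat n n"
  shows "lam n (four_block_mat A B C D) = four_block_mat (- tilde n A) C B A"
  by (simp add: lam_def split_block_four_block[OF assms])

lemma g_alg_four_block_iff:
  assumes "A \<in> carrier_mat n n" "B \<in> carrier_mat n n" "C \<in> carrier_mat n n" "D \<in> carrier_mat n n"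
  shows "four_block_mat A B C D \<in> g_alg n \<longleftrightarrow> D = - tilde n A \<and> tilde n B = B \<and> tilde n C = C"
proof
  assume "four_block_mat A B C D \<in> g_alg n"
  then obtain A' B' C' where *: "A' \<in> carrier_mat n n" "B' \<in> carrier_mat n n" "C' \<in> carrier_mat n n"
      "B' = tilde n B'" "C' = tilde n C'" "four_block_mat A B C D = four_block_mat A' B' C' (- tilde n A')"
    by (auto simp: g_alg_def)
  then have "A = A' \<and> B = B' \<and> C = C' \<and> D = - tilde n A'"
    using assms by (simp add: four_block_mat_eq_iff[of _ n])
  with * show "D = - tilde n A \<and> tilde n B = B \<and> tilde n C = C" by metis
next
  assume "D = - tilde n A \<and> tilde n B = B \<and> tilde n C = C"
  then have "D = - tilde n A" "B = tilde n B" "C = tilde n C" by simp_all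
  with assms(1-3) show "four_block_mat A B C D \<in> g_alg n"
    unfolding g_alg_def by blast
qed

lemma g_alg_carrier: "g_alg n \<subseteq> carrier_mat (2 * n) (2 * n)"
  by (auto simp: g_alg_def intro!: four_block_mat_carrier_double)

lemma g_alg_cases:
  assumes "Z \<in> g_alg n"
  obtains A B C where "A \<in> carrier_mat n n" "B \<in> carrier_mat n n" "C \<in> carrier_mat n n"
    "tilde n B = B" "tilde n C = C" "Z = four_block_mat A B C (- tilde n A)"
proof -
  obtain A B C where "A \<in> carrier_mat n n" "B \<in> carrier_mat n n" "C \<in> carrier_mat n n"
    "B = tilde n B" "C = tilde n C" "Z = four_block_mat A B C (- tilde n A)"
    using assms unfolding g_alg_def by blast
  then show ?thesis using that by metis
qed

text \<open>The diagonal blocks of the defining equation say that \<open>C\<close> and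
  \<open>B\<close> are symmetric. The off-diagonal blocks are transposes of each other up to sign,
  so both of them express \<open>D = - A\<^sup>T\<close>.\<close>

lemma sp_four_block_iff:
  assumes [simp]: "A \<in> carrier_mat n n" "B \<in> carrier_mat n n" "C \<in> carrier_mat n n" "D \<in> carrier_mat n n"
  shows "four_block_mat A B C D \<in> sp n \<longleftrightarrow> D = - A\<^sup>T \<and> B\<^sup>T = B \<and> C\<^sup>T = C"
proof -
  have right_mult_uminus_one: "X * - 1\<^sub>m n = - X" if "X \<in> carrier_mat n n" for X :: "complex mat"
    using that by simp
  have left_mult_uminus_one: "- 1\<^sub>m n * X = - X" if "X \<in> carrier_mat n n" for X :: "complex mat"
    using that by simp
  have "(four_block_mat A B C D)\<^sup>T * symp_form n
      = four_block_mat (- C\<^sup>T) (A\<^sup>T) (- D\<^sup>T) (B\<^sup>T)"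
    unfolding symp_form_def
    by (subst transpose_four_block_mat[of _ n n _ n _ n], simp_all)
       (subst mult_four_block_mat[of _ n n _ n _ n _ _ n _ n], simp_all add: right_mult_uminus_one right_mult_zero_mat[of _ n n] right_mult_one_mat[of _ n n])
  moreover have "symp_form n * four_block_mat A B C D = four_block_mat C D (- A) (- B)"
    unfolding symp_form_def
    by (subst mult_four_block_mat[of _ n n _ n _ n _ _ n _ n], simp_all add: left_mult_uminus_one left_mult_zero_mat[of _ n n] left_mult_one_mat[of _ n n])
  ultimately have "(four_block_mat A B C D)\<^sup>T * symp_form n + symp_form n * four_block_mat A B C D
      = four_block_mat (- C\<^sup>T + C) (A\<^sup>T + D) (- D\<^sup>T + - A) (B\<^sup>T + - B)"
    by (simp add: add_four_block_mat[of _ n n _ n _ n])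
  then have "four_block_mat A B C D \<in> sp n \<longleftrightarrow>
      - C\<^sup>T + C = 0\<^sub>m n n \<and> A\<^sup>T + D = 0\<^sub>m n n \<and> - D\<^sup>T + - A = 0\<^sub>m n n \<and> B\<^sup>T + - B = 0\<^sub>m n n"
    unfolding sp_def zero_eq_four_block_mat
    by (simp add: four_block_mat_carrier_double four_block_mat_eq_iff[of _ n] del: four_block_zero_mat)
  also have "\<dots> \<longleftrightarrow> - C\<^sup>T = - C \<and> A\<^sup>T = - D \<and> - D\<^sup>T = A \<and> B\<^sup>T = B"
    by (simp add: add_eq_zero_mat_iff[of _ n n])
  also have "\<dots> \<longleftrightarrow> D = - A\<^sup>T \<and> B\<^sup>T = B \<and> C\<^sup>T = C"
  proof -
    have "- C\<^sup>T = - C \<longleftrightarrow> C\<^sup>T = C" by (metis uminus_uminus_mat)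
    moreover have "A\<^sup>T = - D \<longleftrightarrow> D = - A\<^sup>T" by (metis uminus_uminus_mat)
    moreover have "- D\<^sup>T = A" if "D = - A\<^sup>T" unfolding that by (rule eq_matI) auto
    ultimately show ?thesis by blast
  qed
  finally show ?thesis .
qed

section \<open>The involution and its eigenspaces\<close>

lemma mult_square_carrier[simp]:
  "X \<in> carrier_mat n n \<Longrightarrow> Y \<in> carrier_mat n n \<Longrightarrow> X * Y \<in> carrier_mat n n"
  by (rule mult_carrier_mat)

lemma uminus_eq_iff_mat: "- A = B \<longleftrightarrow> A = - (B :: 'a :: group_add mat)"
  by (metis uminus_uminus_mat)

section \<open>Conjugation of matrices\<close>

text \<open>In a product of two conjugates the inner factor \<open>Q * P\<close> cancels, so
  conjugation is multiplicative and respects brackets. It is applied to \<open>J_block\<close>,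
  \<open>swap_block\<close> and the square root of \<open>J\<close>.\<close>

lemma
  fixes P Q X Y :: "complex mat"
  assumes P: "P \<in> carrier_mat n n" and Q: "Q \<in> carrier_mat n n"
    and X: "X \<in> carrier_mat n n" and Y: "Y \<in> carrier_mat n n"
  shows conj_add: "P * (X + Y) * Q = P * X * Q + P * Y * Q"
    and conj_lie_bracket: "Q * P = 1\<^sub>m n \<Longrightarrow> P * lie_bracket X Y * Q = lie_bracket (P * X * Q) (P * Y * Q)"
proof -
  note c = P Q X Y
  show "P * (X + Y) * Q = P * X * Q + P * Y * Q"
    using c by (simp add: mult_add_distrib_mat[of _ n n _ n] add_mult_distrib_mat[of _ n n _ _ n])
  assume QP: "Q * P = 1\<^sub>m n"
  have "P * A * Q * (P * B * Q) = P * (A * B) * Q"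
    if A: "A \<in> carrier_mat n n" and B: "B \<in> carrier_mat n n" for A B
  proof -
    have "P * A * Q * (P * B * Q) = P * A * (Q * P) * (B * Q)"
      using P Q A B by (simp add: assoc_mult_mat[of _ n n _ n _ n])
    also have "\<dots> = P * (A * B) * Q"
      unfolding QP using P Q A B by (simp add: assoc_mult_mat[of _ n n _ n _ n] right_mult_one_mat[of _ n n])
    finally show ?thesis .
  qed
  with c show "P * lie_bracket X Y * Q = lie_bracket (P * X * Q) (P * Y * Q)"
    unfolding lie_bracket_def
    by (simp add: mult_minus_distrib_mat[of _ n n _ n] minus_mult_distrib_mat[of _ n n _ _ n])
qed

lemma conj_smult:
  fixes P Q X :: "complex mat"
  assumes "P \<in> carrier_mat n n" "Q \<in> carrier_mat n n" "X \<in> carrier_mat n n"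
  shows "P * (c \<cdot>\<^sub>m X) * Q = c \<cdot>\<^sub>m (P * X * Q)"
  using assms by (simp add: mult_smult_distrib[of _ n n _ n] mult_smult_assoc_mat[of _ n n _ n])

lemma conj_conj:
  fixes P Q X :: "complex mat"
  assumes P: "P \<in> carrier_mat n n" and Q: "Q \<in> carrier_mat n n" and X: "X \<in> carrier_mat n n"
    and QP: "Q * P = 1\<^sub>m n"
  shows "Q * (P * X * Q) * P = X"
proof -
  have "Q * (P * X * Q) * P = Q * P * X * (Q * P)"
    using P Q X by (simp add: assoc_mult_mat[of _ n n _ n _ n])
  then show ?thesis using X by (simp add: QP)
qed

text \<open>The transpose is \<open>J * X\<^sup>T\<close>, and inserting \<open>J * J = 1\<close> on
  the right produces \<open>tilde\<close>. This is the counterpart of \<open>tilde_mult_J\<close>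
  for the way back from \<open>g_alg\<close> to \<open>sp\<close>.\<close>

lemma transpose_mult_J: "X \<in> carrier_mat n n \<Longrightarrow> (X * J_mat n)\<^sup>T = tilde n X * J_mat n"
  by (rule eq_matI) (auto simp: mult_J_index simp del: index_mult_mat(1))

lemma transpose_J_mult: "X \<in> carrier_mat n n \<Longrightarrow> (J_mat n * X)\<^sup>T = J_mat n * tilde n X"
  by (rule eq_matI) (auto simp: J_mult_index simp del: index_mult_mat(1))

section \<open>The isomorphism with the symplectic algebra\<close>

lemma sp_carrier: "sp n \<subseteq> carrier_mat (2 * n) (2 * n)"
  by (auto simp: sp_def)

lemma sp_lie_subalgebra: "lie_subalgebra (2 * n) (sp n)"
  unfolding sp_def
  by (rule form_algebra_lie_subalgebra) (simp add: symp_form_def four_block_mat_carrier_double)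

text \<open>Reversing the last \<open>n\<close> coordinates turns the standard symplectic form into
  the one with blocks \<open>0, J, -J, 0\<close>, and \<open>g_alg\<close> is the algebra of that
  form.\<close>

definition J_block :: "nat \<Rightarrow> complex mat" where
  "J_block n = four_block_mat (1\<^sub>m n) (0\<^sub>m n n) (0\<^sub>m n n) (J_mat n)"

lemma J_block_carrier: "J_block n \<in> carrier_mat (2 * n) (2 * n)"
  by (simp add: J_block_def four_block_mat_carrier_double)

lemma J_block_involution: "J_block n * J_block n = 1\<^sub>m (2 * n)"
  unfolding J_block_def
  by (subst mult_four_block_mat[of _ n n _ n _ n _ _ n _ n]) (simp_all add: mult_2)

lemma J_block_conj:
  assumes [simp]: "A \<in> carrier_mat n n" "B \<in> carrier_mat n n" "C \<in> carrier_mat n n" "D \<in> carrier_mat n n"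
  shows "J_block n * four_block_mat A B C D * J_block n
    = four_block_mat A (B * J_mat n) (J_mat n * C) (J_mat n * D * J_mat n)"
proof -
  note zero_one = left_mult_zero_mat[of _ n n] right_mult_zero_mat[of _ n n]
    left_mult_one_mat[of _ n n] right_mult_one_mat[of _ n n]
    left_add_zero_mat[of _ n n] right_add_zero_mat[of _ n n]
  have "J_block n * four_block_mat A B C D = four_block_mat A B (J_mat n * C) (J_mat n * D)"
    unfolding J_block_def
    by (subst mult_four_block_mat[of _ n n _ n _ n _ _ n _ n]) (simp_all add: zero_one)
  then show ?thesis
    unfolding J_block_def
    by (simp, subst mult_four_block_mat[of _ n n _ n _ n _ _ n _ n]) (simp_all add: zero_one)
qed

text \<open>\<open>J_block\<close> is its own inverse, so one conjugation serves in both directions.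
  It matches symmetric off-diagonal blocks with \<open>tilde\<close>-symmetric ones, and
  \<open>- A\<^sup>T\<close> with \<open>- tilde n A\<close>.\<close>

lemma lie_iso_sp_g_alg:
  "lie_iso (2 * n) (sp n) (2 * n) (g_alg n) (\<lambda>Z. J_block n * Z * J_block n)"
  "lie_iso (2 * n) (g_alg n) (2 * n) (sp n) (\<lambda>Z. J_block n * Z * J_block n)"
proof (atomize(full), rule conjI)
  let ?f = "\<lambda>Z. J_block n * Z * J_block n"
  have to_g: "?f Z \<in> g_alg n" if Z: "Z \<in> sp n" for Z
  proof -
    obtain A B C D where c[simp]: "A \<in> carrier_mat n n" "B \<in> carrier_mat n n" "C \<in> carrier_mat n n"
      "D \<in> carrier_mat n n" and Zeq: "Z = four_block_mat A B C D"
      using carrier_mat_four_block_cases Z sp_carrier by blast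
    have D: "D = - A\<^sup>T" and BC: "B\<^sup>T = B" "C\<^sup>T = C"
      using Z unfolding Zeq sp_four_block_iff[OF c] by auto
    have "J_mat n * D * J_mat n = - tilde n A"
      unfolding D tilde_def by (simp add: carrier_matD[OF c(1)])
    then show ?thesis
      unfolding Zeq J_block_conj[OF c]
      by (subst g_alg_four_block_iff) (simp_all add: tilde_mult_J tilde_J_mult BC)
  qed
  have to_sp: "?f Z \<in> sp n" if Z: "Z \<in> g_alg n" for Z
  proof -
    obtain A B C where c[simp]: "A \<in> carrier_mat n n" "B \<in> carrier_mat n n" "C \<in> carrier_mat n n"
      and BC: "tilde n B = B" "tilde n C = C" and Zeq: "Z = four_block_mat A B C (- tilde n A)"
      using Z by (rule g_alg_cases)
    have "J_mat n * (- tilde n A) * J_mat n = - A\<^sup>T"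
      unfolding tilde_def using c(1) J_conj_J[of "A\<^sup>T" n] by simp
    then show ?thesis
      unfolding Zeq
      by (subst J_block_conj, simp_all, subst sp_four_block_iff)
         (simp_all add: transpose_mult_J transpose_J_mult BC)
  qed
  have carr: "Z \<in> carrier_mat (2 * n) (2 * n)" if "Z \<in> sp n \<or> Z \<in> g_alg n" for Z
    using that sp_carrier g_alg_carrier by blast
  note iso = lie_iso_transport[OF sp_lie_subalgebra g_alg_carrier, of n ?f n ?f]
  note K = J_block_carrier J_block_carrier
  show "lie_iso (2 * n) (sp n) (2 * n) (g_alg n) ?f"
    by (rule iso(1)) (simp_all add: to_g to_sp carr conj_conj[OF K _ J_block_involution]
        conj_add[OF K] conj_smult[OF K] conj_lie_bracket[OF K _ _ J_block_involution])
  show "lie_iso (2 * n) (g_alg n) (2 * n) (sp n) ?f"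
    by (rule iso(2)) (simp_all add: to_g to_sp carr conj_conj[OF K _ J_block_involution]
        conj_add[OF K] conj_smult[OF K] conj_lie_bracket[OF K _ _ J_block_involution])
qed

text \<open>Closure under brackets is inherited from \<open>sp\<close> through the isomorphism,
  which avoids a computation with blocks.\<close>

lemma g_alg_lie_subalgebra: "lie_subalgebra (2 * n) (g_alg n)"
  using lie_iso_sp_g_alg by (simp add: lie_iso_def)

section \<open>The involution as a conjugation\<close>

definition swap_block :: "nat \<Rightarrow> complex mat" where
  "swap_block n = four_block_mat (0\<^sub>m n n) (1\<^sub>m n) (1\<^sub>m n) (0\<^sub>m n n)"

lemma swap_block_carrier: "swap_block n \<in> carrier_mat (2 * n) (2 * n)"
  by (simp add: swap_block_def four_block_mat_carrier_double)

lemma swap_block_involution: "swap_block n * swap_block n = 1\<^sub>m (2 * n)"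
  unfolding swap_block_def
  by (subst mult_four_block_mat[of _ n n _ n _ n _ _ n _ n]) (simp_all add: mult_2)

lemma swap_block_conj:
  assumes [simp]: "A \<in> carrier_mat n n" "B \<in> carrier_mat n n" "C \<in> carrier_mat n n" "D \<in> carrier_mat n n"
  shows "swap_block n * four_block_mat A B C D * swap_block n = four_block_mat D C B A"
proof -
  note zero_one = left_mult_zero_mat[of _ n n] right_mult_zero_mat[of _ n n]
    left_mult_one_mat[of _ n n] right_mult_one_mat[of _ n n]
    left_add_zero_mat[of _ n n] right_add_zero_mat[of _ n n]
  have "swap_block n * four_block_mat A B C D = four_block_mat C D A B"
    unfolding swap_block_def
    by (subst mult_four_block_mat[of _ n n _ n _ n _ _ n _ n]) (simp_all add: zero_one)
  then show ?thesis
    unfolding swap_block_def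
    by (simp, subst mult_four_block_mat[of _ n n _ n _ n _ _ n _ n]) (simp_all add: zero_one)
qed

text \<open>On \<open>g_alg\<close> the block \<open>- tilde n A\<close> that \<open>lam\<close>
  puts into the top left corner is the old bottom right block, so \<open>lam\<close> exchanges
  opposite blocks. Outside \<open>g_alg\<close> the two maps differ in general.\<close>

lemma lam_eq_conj:
  assumes "Z \<in> g_alg n"
  shows "lam n Z = swap_block n * Z * swap_block n"
proof -
  obtain A B C where [simp]: "A \<in> carrier_mat n n" "B \<in> carrier_mat n n" "C \<in> carrier_mat n n"
    and Zeq: "Z = four_block_mat A B C (- tilde n A)"
    using assms by (rule g_alg_cases)
  show ?thesis unfolding Zeq by (simp add: lam_four_block swap_block_conj)
qed

lemma lam_g_alg:
  assumes "Z \<in> g_alg n"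
  shows "lam n Z \<in> g_alg n"
proof -
  obtain A B C where [simp]: "A \<in> carrier_mat n n" "B \<in> carrier_mat n n" "C \<in> carrier_mat n n"
    "tilde n B = B" "tilde n C = C" and Zeq: "Z = four_block_mat A B C (- tilde n A)"
    using assms by (rule g_alg_cases)
  show ?thesis unfolding Zeq by (simp add: lam_four_block g_alg_four_block_iff tilde_uminus)
qed

lemma g_alg_closed:
  "X \<in> g_alg n \<Longrightarrow> X \<in> carrier_mat (2 * n) (2 * n)"
  "X \<in> g_alg n \<Longrightarrow> Y \<in> g_alg n \<Longrightarrow> X + Y \<in> g_alg n"
  "X \<in> g_alg n \<Longrightarrow> c \<cdot>\<^sub>m X \<in> g_alg n"
  "X \<in> g_alg n \<Longrightarrow> Y \<in> g_alg n \<Longrightarrow> lie_bracket X Y \<in> g_alg n"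
  "0\<^sub>m (2 * n) (2 * n) \<in> g_alg n"
  using g_alg_lie_subalgebra[of n] by (auto simp: lie_subalgebra_def mat_subspace_iff)

lemma lam_simps:
  assumes "X \<in> g_alg n"
  shows lam_lam: "lam n (lam n X) = X"
    and lam_smult: "lam n (c \<cdot>\<^sub>m X) = c \<cdot>\<^sub>m lam n X"
    and lam_add: "Y \<in> g_alg n \<Longrightarrow> lam n (X + Y) = lam n X + lam n Y"
    and lam_lie_bracket: "Y \<in> g_alg n \<Longrightarrow> lam n (lie_bracket X Y) = lie_bracket (lam n X) (lam n Y)"
proof -
  note S = swap_block_carrier swap_block_carrier
  show "lam n (lam n X) = X"
    \<comment> \<open>The outer \<open>lam\<close> is unfolded first, while its argument still has
      the form \<open>lam n X\<close> and is known to lie in \<open>g_alg\<close>.\<close>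
    unfolding lam_eq_conj[OF lam_g_alg[OF assms]] unfolding lam_eq_conj[OF assms]
    by (rule conj_conj[OF S g_alg_closed(1)[OF assms] swap_block_involution])
  show "lam n (c \<cdot>\<^sub>m X) = c \<cdot>\<^sub>m lam n X"
    using assms by (simp add: lam_eq_conj g_alg_closed conj_smult[OF S])
  assume "Y \<in> g_alg n"
  with assms show "lam n (X + Y) = lam n X + lam n Y"
    "lam n (lie_bracket X Y) = lie_bracket (lam n X) (lam n Y)"
    by (simp_all add: lam_eq_conj g_alg_closed conj_add[OF S] conj_lie_bracket[OF S _ _ swap_block_involution])
qed

lemma lie_iso_lam: "lie_iso (2 * n) (g_alg n) (2 * n) (g_alg n) (lam n)"
  by (rule lie_iso_transport(1)[OF g_alg_lie_subalgebra g_alg_carrier, where g = "lam n"])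
     (simp_all add: lam_g_alg lam_simps)

lemma lam_zero: "lam n (0\<^sub>m (2 * n) (2 * n)) = 0\<^sub>m (2 * n) (2 * n)"
proof -
  have "- 0\<^sub>m n n = (0\<^sub>m n n :: complex mat)" by (rule eq_matI) auto
  then show ?thesis unfolding zero_eq_four_block_mat
    by (simp add: lam_four_block del: four_block_zero_mat)
qed

text \<open>The fixed points of an automorphism are closed under all operations. For
  \<open>g1\<close> only the subspace property is claimed, as the bracket of two \<open>-1\<close>
  eigenvectors is a fixed point.\<close>

lemma g0_lie_subalgebra: "lie_subalgebra (2 * n) (g0 n)"
  unfolding lie_subalgebra_def mat_subspace_iff g0_def
  by (auto simp: g_alg_closed lam_simps lam_zero)

lemma g1_subspace: "mat_subspace (2 * n) (g1 n)"
proof -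
  have "- (X + Y) = - X + - Y" if "X \<in> g_alg n" "Y \<in> g_alg n" for X Y
    using that[THEN g_alg_closed(1)] by auto
  moreover have "- (c \<cdot>\<^sub>m X) = c \<cdot>\<^sub>m - X" for c and X :: "complex mat"
    by (rule eq_matI) auto
  moreover have "lam n (0\<^sub>m (2 * n) (2 * n)) = - 0\<^sub>m (2 * n) (2 * n)"
    unfolding lam_zero by (rule eq_matI) auto
  ultimately show ?thesis
    unfolding mat_subspace_iff g1_def
    by (auto simp: g_alg_closed lam_simps)
qed

section \<open>Explicit form of the eigenspaces\<close>

text \<open>Comparing blocks in \<open>lam n Z = Z\<close> gives \<open>A = - tilde n A\<close> and
  \<open>B = C\<close>, each of them twice. For \<open>g1\<close> the same comparison gives
  \<open>tilde n A = A\<close> and \<open>C = - B\<close>.\<close>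

lemma g0_eq:
  "g0 n = {four_block_mat X Y Y X | X Y.
     X \<in> carrier_mat n n \<and> Y \<in> carrier_mat n n \<and> tilde n X = - X \<and> tilde n Y = Y}"
proof (intro equalityI subsetI)
  fix Z assume "Z \<in> g0 n"
  then have Z: "Z \<in> g_alg n" and lam: "lam n Z = Z" by (auto simp: g0_def)
  obtain A B C where c[simp]: "A \<in> carrier_mat n n" "B \<in> carrier_mat n n" "C \<in> carrier_mat n n"
    and BC: "tilde n B = B" "tilde n C = C" and Zeq: "Z = four_block_mat A B C (- tilde n A)"
    using Z by (rule g_alg_cases)
  have "four_block_mat (- tilde n A) C B A = four_block_mat A B C (- tilde n A)"
    using lam unfolding Zeq by (simp only: lam_four_block c uminus_carrier_iff_mat tilde_carrier)
  then have "- tilde n A = A \<and> C = B \<and> B = C \<and> A = - tilde n A"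
    \<comment> \<open>The rotation moves the eight carrier premises behind the block equation, so
      that the chained fact meets the first premise.\<close>
    by (rule iffD1[OF four_block_mat_eq_iff[of _ n], rotated 8]) simp_all
  then have *: "- tilde n A = A" "C = B" by blast+
  have "Z = four_block_mat A B B A" unfolding Zeq * ..
  moreover have "tilde n A = - A" using *(1) unfolding uminus_eq_iff_mat .
  ultimately show "Z \<in> {four_block_mat X Y Y X | X Y.
     X \<in> carrier_mat n n \<and> Y \<in> carrier_mat n n \<and> tilde n X = - X \<and> tilde n Y = Y}"
    using BC(1) c(1,2) by blast
next
  fix Z assume "Z \<in> {four_block_mat X Y Y X | X Y.
     X \<in> carrier_mat n n \<and> Y \<in> carrier_mat n n \<and> tilde n X = - X \<and> tilde n Y = Y}"
  then show "Z \<in> g0 n"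
    by (auto simp: g0_def g_alg_four_block_iff lam_four_block)
qed

lemma g1_eq:
  "g1 n = {four_block_mat X Y (- Y) (- X) | X Y.
     X \<in> carrier_mat n n \<and> Y \<in> carrier_mat n n \<and> tilde n X = X \<and> tilde n Y = Y}"
proof (intro equalityI subsetI)
  fix Z assume "Z \<in> g1 n"
  then have Z: "Z \<in> g_alg n" and lam: "lam n Z = - Z" by (auto simp: g1_def)
  obtain A B C where c[simp]: "A \<in> carrier_mat n n" "B \<in> carrier_mat n n" "C \<in> carrier_mat n n"
    and BC: "tilde n B = B" "tilde n C = C" and Zeq: "Z = four_block_mat A B C (- tilde n A)"
    using Z by (rule g_alg_cases)
  have "four_block_mat (- tilde n A) C B A = four_block_mat (- A) (- B) (- C) (- (- tilde n A))"
    using lam unfolding Zeq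
    by (simp only: lam_four_block uminus_four_block_mat[of _ n] c uminus_carrier_iff_mat tilde_carrier)
  then have "- tilde n A = - A \<and> C = - B \<and> B = - C \<and> A = - (- tilde n A)"
    by (rule iffD1[OF four_block_mat_eq_iff[of _ n], rotated 8]) simp_all
  then have *: "tilde n A = A" "C = - B" by (metis uminus_uminus_mat)+
  have "Z = four_block_mat A B (- B) (- A)" unfolding Zeq * ..
  with * show "Z \<in> {four_block_mat X Y (- Y) (- X) | X Y.
     X \<in> carrier_mat n n \<and> Y \<in> carrier_mat n n \<and> tilde n X = X \<and> tilde n Y = Y}"
    using BC(1) c(1,2) by blast
next
  fix Z assume "Z \<in> {four_block_mat X Y (- Y) (- X) | X Y.
     X \<in> carrier_mat n n \<and> Y \<in> carrier_mat n n \<and> tilde n X = X \<and> tilde n Y = Y}"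
  then show "Z \<in> g1 n"
    by (auto simp: g1_def g_alg_four_block_iff lam_four_block tilde_uminus uminus_four_block_mat[of _ n])
qed

lemma g0_tilde_eq:
  "g0_tilde n = {four_block_mat X (0\<^sub>m n n) (0\<^sub>m n n) X | X. X \<in> carrier_mat n n \<and> tilde n X = - X}"
proof -
  have "four_block_mat X (0\<^sub>m n n) (0\<^sub>m n n) X \<in> g0 n \<longleftrightarrow> tilde n X = - X" if "X \<in> carrier_mat n n" for X
  proof -
    have "four_block_mat X (0\<^sub>m n n) (0\<^sub>m n n) X \<in> g0 n \<longleftrightarrow> X = - tilde n X \<and> - tilde n X = X"
      using that
      by (simp add: g0_def g_alg_four_block_iff lam_four_block four_block_mat_eq_iff[of _ n])
    then show ?thesis using uminus_eq_iff_mat[of "tilde n X" X] by metis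
  qed
  then show ?thesis unfolding g0_tilde_def by auto
qed

lemma V_part_eq:
  "V_part n = {four_block_mat (0\<^sub>m n n) Y Y (0\<^sub>m n n) | Y. Y \<in> carrier_mat n n \<and> tilde n Y = Y}"
proof -
  have "four_block_mat (0\<^sub>m n n) Y Y (0\<^sub>m n n) \<in> g0 n \<longleftrightarrow> tilde n Y = Y" if "Y \<in> carrier_mat n n" for Y
    using that
    by (auto simp: g0_def g_alg_four_block_iff lam_four_block four_block_mat_eq_iff[of _ n])
  then show ?thesis unfolding V_part_def by auto
qed

section \<open>Direct sums and the eigenspace decomposition\<close>

text \<open>Closure of \<open>L\<close> under addition supplies one inclusion of the sum formula,
  and zero lies in both summands, so a splitting and a trivial intersection remain to be
  shown.\<close>

lemma mat_direct_sumI: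
  assumes L: "mat_subspace N L" and L1: "mat_subspace N L1" and L2: "mat_subspace N L2"
    and sub: "L1 \<subseteq> L" "L2 \<subseteq> L"
    and split: "\<And>Z. Z \<in> L \<Longrightarrow> \<exists>X\<in>L1. \<exists>Y\<in>L2. Z = X + Y"
    and inter: "L1 \<inter> L2 \<subseteq> {0\<^sub>m N N}"
  shows "mat_direct_sum N L L1 L2"
proof -
  have "L = {X + Y | X Y. X \<in> L1 \<and> Y \<in> L2}"
    using split L sub unfolding mat_subspace_iff by blast
  moreover have "L1 \<inter> L2 = {0\<^sub>m N N}"
    using inter L1 L2 unfolding mat_subspace_iff by blast
  ultimately show ?thesis unfolding mat_direct_sum_def using L1 L2 by blast
qed

lemma g0_subspace: "mat_subspace (2 * n) (g0 n)"
  using g0_lie_subalgebra by (simp add: lie_subalgebra_def)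

lemma direct_sum_g0_g1: "mat_direct_sum (2 * n) (g_alg n) (g0 n) (g1 n)"
proof (rule mat_direct_sumI)
  show "mat_subspace (2 * n) (g_alg n)"
    using g_alg_lie_subalgebra by (simp add: lie_subalgebra_def)
  show "\<exists>X\<in>g0 n. \<exists>Y\<in>g1 n. Z = X + Y" if Z: "Z \<in> g_alg n" for Z
  proof -
    \<comment> \<open>\<open>Z\<close> is split into half of \<open>Z + lam n Z\<close>, which is
      fixed, and half of \<open>Z - lam n Z\<close>, which changes sign. The difference is written
      with the scalar \<open>-1\<close> so that the rules for sums and multiples apply.\<close>
    let ?L = "lam n Z"
    let ?X = "(1/2) \<cdot>\<^sub>m (Z + ?L)" and ?Y = "(1/2) \<cdot>\<^sub>m (Z + (-1) \<cdot>\<^sub>m ?L)"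
    note L = lam_g_alg[OF Z]
    note cl = Z L g_alg_closed(2,3) lam_simps
    have c: "Z \<in> carrier_mat (2 * n) (2 * n)" "?L \<in> carrier_mat (2 * n) (2 * n)"
      using Z L by (simp_all add: g_alg_closed(1))
    have "lam n ?X = (1/2) \<cdot>\<^sub>m (?L + Z)" by (simp add: cl)
    also have "\<dots> = ?X" by (rule eq_matI) (use c in \<open>auto simp: algebra_simps\<close>)
    finally have "?X \<in> g0 n" by (simp add: g0_def cl)
    moreover have "lam n ?Y = (1/2) \<cdot>\<^sub>m (?L + (-1) \<cdot>\<^sub>m Z)" by (simp add: cl)
    then have "lam n ?Y = - ?Y" using c by (auto simp: algebra_simps diff_divide_distrib)
    then have "?Y \<in> g1 n" by (simp add: g1_def cl)
    moreover have "Z = ?X + ?Y" by (rule eq_matI) (use c in \<open>auto simp: algebra_simps\<close>)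
    ultimately show ?thesis by blast
  qed
  show "g0 n \<inter> g1 n \<subseteq> {0\<^sub>m (2 * n) (2 * n)}"
  proof
    fix Z assume "Z \<in> g0 n \<inter> g1 n"
    \<comment> \<open>Both \<open>Z\<close> and \<open>- Z\<close> equal \<open>lam n Z\<close>, and
      in characteristic 0 this leaves only zero.\<close>
    then have Z: "Z \<in> carrier_mat (2 * n) (2 * n)" and eq: "Z = - Z"
      by (auto simp: g0_def g1_def g_alg_closed(1))
    have "Z $$ (i, j) = 0" if "i < 2 * n" "j < 2 * n" for i j
    proof -
      have "Z $$ (i, j) = (- Z) $$ (i, j)" using eq by simp
      also have "\<dots> = - Z $$ (i, j)" using Z that by simp
      finally show ?thesis by simp
    qed
    then show "Z \<in> {0\<^sub>m (2 * n) (2 * n)}" using Z by (auto intro!: eq_matI)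
  qed
qed (simp_all add: g0_subspace g1_subspace, auto simp: g0_def g1_def)

section \<open>A square root of \<open>J\<close> and the isomorphism with \<open>so\<close>\<close>

text \<open>\<open>(a 1 + b J)\<^sup>2 = (a\<^sup>2 + b\<^sup>2) 1 + 2 a b J\<close> equals \<open>J\<close> for \<open>a = (1 - \<i>) / 2\<close>, \<open>b = (1 + \<i>) / 2\<close>.\<close>

definition sqrt_J :: "nat \<Rightarrow> complex mat" where
  "sqrt_J n = ((1 - \<i>) / 2) \<cdot>\<^sub>m 1\<^sub>m n + ((1 + \<i>) / 2) \<cdot>\<^sub>m J_mat n"

text \<open>As \<open>P^2 = J\<close> and \<open>J^2 = 1\<close>, the inverse of \<open>P\<close> is
  \<open>J P\<close>, and multiplying by \<open>J\<close> exchanges the two coefficients.\<close>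

definition sqrt_J_inv :: "nat \<Rightarrow> complex mat" where
  "sqrt_J_inv n = ((1 + \<i>) / 2) \<cdot>\<^sub>m 1\<^sub>m n + ((1 - \<i>) / 2) \<cdot>\<^sub>m J_mat n"

lemma sqrt_J_carrier[simp]: "sqrt_J n \<in> carrier_mat n n" "sqrt_J_inv n \<in> carrier_mat n n"
  by (auto simp: sqrt_J_def sqrt_J_inv_def)

lemma sqrt_J_transpose: "(sqrt_J n)\<^sup>T = sqrt_J n" "(sqrt_J_inv n)\<^sup>T = sqrt_J_inv n"
  unfolding sqrt_J_def sqrt_J_inv_def by (rule eq_matI; auto simp: J_mat_def)+

text \<open>Because \<open>J^2 = 1\<close>, the combinations of \<open>1\<close> and
  \<open>J\<close> form a commutative algebra, in which identities reduce to identities between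
  coefficients.\<close>

lemma comb_J_mult:
  "(a \<cdot>\<^sub>m 1\<^sub>m n + b \<cdot>\<^sub>m J_mat n) * (c \<cdot>\<^sub>m 1\<^sub>m n + d \<cdot>\<^sub>m J_mat n)
    = (a * c + b * d) \<cdot>\<^sub>m 1\<^sub>m n + (a * d + b * c) \<cdot>\<^sub>m J_mat n"
proof -
  have "(a \<cdot>\<^sub>m 1\<^sub>m n + b \<cdot>\<^sub>m J_mat n) * (c \<cdot>\<^sub>m 1\<^sub>m n + d \<cdot>\<^sub>m J_mat n)
     = c \<cdot>\<^sub>m (a \<cdot>\<^sub>m 1\<^sub>m n + b \<cdot>\<^sub>m J_mat n) + d \<cdot>\<^sub>m (a \<cdot>\<^sub>m J_mat n + b \<cdot>\<^sub>m 1\<^sub>m n)"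
    by (simp add: mult_add_distrib_mat[of _ n n _ n] add_mult_distrib_mat[of _ n n _ _ n]
        mult_smult_distrib[of _ n n _ n] mult_smult_assoc_mat[of _ n n _ n]
        left_mult_one_mat[of _ n n] right_mult_one_mat[of _ n n])
  also have "\<dots> = (a * c + b * d) \<cdot>\<^sub>m 1\<^sub>m n + (a * d + b * c) \<cdot>\<^sub>m J_mat n"
    by (rule eq_matI) (auto simp: algebra_simps)
  finally show ?thesis .
qed

lemma sqrt_J_mult:
  "sqrt_J n * sqrt_J_inv n = 1\<^sub>m n" "sqrt_J_inv n * sqrt_J n = 1\<^sub>m n"
  "J_mat n * sqrt_J n = sqrt_J_inv n" "sqrt_J n * J_mat n = sqrt_J_inv n"
  "J_mat n * sqrt_J_inv n = sqrt_J n" "sqrt_J_inv n * J_mat n = sqrt_J n"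
proof -
  \<comment> \<open>This brings the factor \<open>J\<close> itself into the form required by
    \<open>comb_J_mult\<close>. It is substituted at one chosen occurrence, since its right-hand
    side contains \<open>J\<close> again.\<close>
  have J: "J_mat n = 0 \<cdot>\<^sub>m 1\<^sub>m n + 1 \<cdot>\<^sub>m J_mat n"
    by (rule eq_matI) auto
  have i: "(1 - \<i>) / 2 * ((1 + \<i>) / 2) = 1 / 2" "(1 + \<i>) / 2 * ((1 - \<i>) / 2) = 1 / 2"
    "(1 + \<i>) / 2 * ((1 + \<i>) / 2) = \<i> / 2" "(1 - \<i>) / 2 * ((1 - \<i>) / 2) = - \<i> / 2"
    by (simp_all add: complex_eq_iff)
  show "sqrt_J n * sqrt_J_inv n = 1\<^sub>m n"
    unfolding sqrt_J_def sqrt_J_inv_def comb_J_mult i by (rule eq_matI) auto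
  show "sqrt_J_inv n * sqrt_J n = 1\<^sub>m n"
    unfolding sqrt_J_def sqrt_J_inv_def comb_J_mult i by (rule eq_matI) auto
  show "J_mat n * sqrt_J n = sqrt_J_inv n"
    unfolding sqrt_J_def sqrt_J_inv_def by (subst J, subst comb_J_mult, rule eq_matI) auto
  show "sqrt_J n * J_mat n = sqrt_J_inv n"
    unfolding sqrt_J_def sqrt_J_inv_def by (subst (2) J, subst comb_J_mult, rule eq_matI) auto
  show "J_mat n * sqrt_J_inv n = sqrt_J n"
    unfolding sqrt_J_def sqrt_J_inv_def by (subst J, subst comb_J_mult, rule eq_matI) auto
  show "sqrt_J_inv n * J_mat n = sqrt_J n"
    unfolding sqrt_J_def sqrt_J_inv_def by (subst (2) J, subst comb_J_mult, rule eq_matI) auto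
qed

text \<open>\<open>P\<close> is symmetric, so transposing the conjugate exchanges \<open>P\<close>
  and its inverse; the outer factors \<open>J\<close> exchange them back. Thus \<open>tilde\<close>
  on the conjugate corresponds to transposition of \<open>X\<close>.\<close>

lemma tilde_sqrt_J_conj:
  assumes "X \<in> carrier_mat n n"
  shows "tilde n (sqrt_J_inv n * X * sqrt_J n) = sqrt_J_inv n * X\<^sup>T * sqrt_J n"
proof -
  have "tilde n (sqrt_J_inv n * X * sqrt_J n) = (J_mat n * sqrt_J n) * X\<^sup>T * (sqrt_J_inv n * J_mat n)"
    unfolding tilde_def using assms
    by (simp add: transpose_mult[of _ n n _ n] sqrt_J_transpose assoc_mult_mat[of _ n n _ n _ n])
  then show ?thesis by (simp add: sqrt_J_mult)
qed

lemma transpose_sqrt_J_conj: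
  assumes "X \<in> carrier_mat n n"
  shows "(sqrt_J n * X * sqrt_J_inv n)\<^sup>T = sqrt_J n * tilde n X * sqrt_J_inv n"
proof -
  have "(sqrt_J n * X * sqrt_J_inv n)\<^sup>T = sqrt_J_inv n * X\<^sup>T * sqrt_J n"
    using assms by (simp add: transpose_mult[of _ n n _ n] sqrt_J_transpose assoc_mult_mat[of _ n n _ n _ n])
  also have "\<dots> = (sqrt_J n * J_mat n) * X\<^sup>T * (J_mat n * sqrt_J_inv n)"
    by (simp add: sqrt_J_mult)
  also have "\<dots> = sqrt_J n * tilde n X * sqrt_J_inv n"
    unfolding tilde_def using assms by (simp add: assoc_mult_mat[of _ n n _ n _ n] del: sqrt_J_mult)
  finally show ?thesis .
qed

text \<open>\<open>so\<close> is the algebra of the bilinear form given by the identity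
  matrix.\<close>

lemma so_lie_subalgebra: "lie_subalgebra n (so n)"
proof -
  have "so n = {Z \<in> carrier_mat n n. Z\<^sup>T * 1\<^sub>m n + 1\<^sub>m n * Z = 0\<^sub>m n n}"
    unfolding so_def
    by (auto simp: add_eq_zero_mat_iff[of _ n n] left_mult_one_mat[of _ n n] right_mult_one_mat[of _ n n])
  then show ?thesis using form_algebra_lie_subalgebra[of "1\<^sub>m n" n] by simp
qed

definition diag_block :: "nat \<Rightarrow> complex mat \<Rightarrow> complex mat" where
  "diag_block n X = four_block_mat X (0\<^sub>m n n) (0\<^sub>m n n) X"

lemma diag_block_simps:
  assumes [simp]: "X \<in> carrier_mat n n" "Y \<in> carrier_mat n n"
  shows "diag_block n X + diag_block n Y = diag_block n (X + Y)"
    and "lie_bracket (diag_block n X) (diag_block n Y) = diag_block n (lie_bracket X Y)"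
proof -
  show "diag_block n X + diag_block n Y = diag_block n (X + Y)"
    unfolding diag_block_def by (subst add_four_block_mat[of _ n n _ n _ n]) simp_all
  have "diag_block n A * diag_block n B = diag_block n (A * B)"
    if [simp]: "A \<in> carrier_mat n n" "B \<in> carrier_mat n n" for A B
    unfolding diag_block_def
    by (subst mult_four_block_mat[of _ n n _ n _ n _ _ n _ n])
       (simp_all add: left_mult_zero_mat[of _ n n] right_mult_zero_mat[of _ n n] right_add_zero_mat[of _ n n] left_add_zero_mat[of _ n n])
  moreover have "diag_block n A - diag_block n B = diag_block n (A - B)"
    if [simp]: "A \<in> carrier_mat n n" "B \<in> carrier_mat n n" for A B
  proof -
    have zero: "0\<^sub>m n n - 0\<^sub>m n n = (0\<^sub>m n n :: complex mat)" by (rule eq_matI) auto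
    show ?thesis unfolding diag_block_def by (subst minus_four_block_mat[of _ n]) (simp_all add: zero)
  qed
  ultimately show "lie_bracket (diag_block n X) (diag_block n Y) = diag_block n (lie_bracket X Y)"
    unfolding lie_bracket_def by simp
qed

lemma diag_block_smult:
  "X \<in> carrier_mat n n \<Longrightarrow> diag_block n (c \<cdot>\<^sub>m X) = c \<cdot>\<^sub>m diag_block n X"
  unfolding diag_block_def by (subst smult_four_block_mat[of _ n n _ n _ n]) simp_all

text \<open>Conjugation by the square root of \<open>J\<close> matches transpose-skew with
  \<open>tilde\<close>-skew matrices, and \<open>diag_block\<close> repeats the result on the
  diagonal. The inverse reads off the top left block and conjugates back.\<close>

lemma lie_iso_so_g0_tilde:
  fixes n :: nat
  defines "f \<equiv> \<lambda>X. diag_block n (sqrt_J_inv n * X * sqrt_J n)"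
    and "g \<equiv> \<lambda>Z. sqrt_J n * (case split_block Z n n of (A, B, C, D) \<Rightarrow> A) * sqrt_J_inv n"
  shows "lie_iso n (so n) (2 * n) (g0_tilde n) f"
    and "lie_iso (2 * n) (g0_tilde n) n (so n) g"
proof -
  note PQ = sqrt_J_carrier(2,1)
  have g_diag: "g (diag_block n X) = sqrt_J n * X * sqrt_J_inv n" if "X \<in> carrier_mat n n" for X
    unfolding g_def diag_block_def using that by (simp add: split_block_four_block)
  have g0t: "g0_tilde n = diag_block n ` {X \<in> carrier_mat n n. tilde n X = - X}"
    unfolding g0_tilde_eq diag_block_def by blast
  have carr: "X \<in> carrier_mat n n" if "X \<in> so n" for X using that by (simp add: so_def)
  have dims: "dim_row (sqrt_J n) = n" "dim_col (sqrt_J n) = n"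
    "dim_row (sqrt_J_inv n) = n" "dim_col (sqrt_J_inv n) = n"
    by (simp_all only: carrier_matD[OF sqrt_J_carrier(1)] carrier_matD[OF sqrt_J_carrier(2)])
  have f_in: "f X \<in> g0_tilde n" if "X \<in> so n" for X
  proof -
    have X: "X \<in> carrier_mat n n" and skew: "X\<^sup>T = - X" using that by (simp_all add: so_def)
    have "tilde n (sqrt_J_inv n * X * sqrt_J n) = sqrt_J_inv n * (- X) * sqrt_J n"
      unfolding tilde_sqrt_J_conj[OF X] skew ..
    also have "\<dots> = - (sqrt_J_inv n * X * sqrt_J n)"
      by (simp add: dims carrier_matD[OF X])
    finally show ?thesis unfolding f_def g0t using X by (intro imageI CollectI conjI) simp_all
  qed
  have g_in: "g Z \<in> so n" if "Z \<in> g0_tilde n" for Z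
  proof -
    obtain X where X: "X \<in> carrier_mat n n" and skew: "tilde n X = - X" and Z: "Z = diag_block n X"
      using \<open>Z \<in> g0_tilde n\<close> unfolding g0t by blast
    have "(sqrt_J n * X * sqrt_J_inv n)\<^sup>T = sqrt_J n * (- X) * sqrt_J_inv n"
      unfolding transpose_sqrt_J_conj[OF X] skew ..
    also have "\<dots> = - (sqrt_J n * X * sqrt_J_inv n)"
      by (simp add: dims carrier_matD[OF X])
    finally show ?thesis unfolding Z g_diag[OF X] so_def using X
      by (intro CollectI conjI mult_square_carrier sqrt_J_carrier)
  qed
  have gf: "g (f X) = X" if "X \<in> so n" for X
    using carr[OF that] unfolding f_def by (simp add: g_diag conj_conj[OF PQ _ sqrt_J_mult(1)])
  have fg: "f (g Z) = Z" if "Z \<in> g0_tilde n" for Z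
    using that unfolding g0t f_def by (auto simp: g_diag conj_conj[OF PQ(2,1) _ sqrt_J_mult(2)])
  have K: "g0_tilde n \<subseteq> carrier_mat (2 * n) (2 * n)"
    unfolding g0_tilde_eq by (auto intro!: four_block_mat_carrier_double)
  note iso = lie_iso_transport[OF so_lie_subalgebra K, of n f g]
  have add: "f (X + Y) = f X + f Y" if "X \<in> so n" "Y \<in> so n" for X Y
    unfolding f_def using that[THEN carr] by (simp add: conj_add[OF PQ] diag_block_simps)
  have smult: "f (c \<cdot>\<^sub>m X) = c \<cdot>\<^sub>m f X" if "X \<in> so n" for c X
    unfolding f_def using that[THEN carr] by (simp add: conj_smult[OF PQ] diag_block_smult)
  have bracket: "f (lie_bracket X Y) = lie_bracket (f X) (f Y)" if "X \<in> so n" "Y \<in> so n" for X Y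
    unfolding f_def using that[THEN carr]
    by (simp add: conj_lie_bracket[OF PQ _ _ sqrt_J_mult(1)] diag_block_simps)
  show "lie_iso n (so n) (2 * n) (g0_tilde n) f"
    by (rule iso(1)) (simp_all add: f_in g_in gf fg add smult bracket)
  show "lie_iso (2 * n) (g0_tilde n) n (so n) g"
    by (rule iso(2)) (simp_all add: f_in g_in gf fg add smult bracket)
qed

section \<open>The isomorphism with \<open>gl\<close>\<close>

definition sum_top_blocks :: "nat \<Rightarrow> complex mat \<Rightarrow> complex mat" where
  "sum_top_blocks n Z = (case split_block Z n n of (A, B, C, D) \<Rightarrow> A + B)"

lemma sum_top_blocks_four_block:
  "A \<in> carrier_mat n n \<Longrightarrow> B \<in> carrier_mat n n \<Longrightarrow> C \<in> carrier_mat n n \<Longrightarrow> D \<in> carrier_mat n n \<Longrightarrow>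
   sum_top_blocks n (four_block_mat A B C D) = A + B"
  by (simp add: sum_top_blocks_def split_block_four_block)

text \<open>This is the inverse of \<open>sum_top_blocks\<close> on \<open>g0\<close>, built from
  the \<open>tilde\<close>-skew and the \<open>tilde\<close>-symmetric part of
  \<open>M\<close>.\<close>

definition skew_sym_blocks :: "nat \<Rightarrow> complex mat \<Rightarrow> complex mat" where
  "skew_sym_blocks n M =
    (let X = (1/2) \<cdot>\<^sub>m (M - tilde n M); Y = (1/2) \<cdot>\<^sub>m (M + tilde n M) in four_block_mat X Y Y X)"

lemma g0_cases:
  assumes "Z \<in> g0 n"
  obtains X Y where "X \<in> carrier_mat n n" "Y \<in> carrier_mat n n" "tilde n X = - X" "tilde n Y = Y"
    "Z = four_block_mat X Y Y X"
  using assms unfolding g0_eq by blast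

text \<open>The top blocks of the product are \<open>X * X' + Y * Y'\<close> and
  \<open>X * Y' + Y * X'\<close>, which add up to \<open>(X + Y) * (X' + Y')\<close>. The sum of the
  top blocks is therefore multiplicative on such matrices.\<close>

lemma sum_top_blocks_lie_bracket:
  assumes c: "X \<in> carrier_mat n n" "Y \<in> carrier_mat n n" "X' \<in> carrier_mat n n" "Y' \<in> carrier_mat n n"
  shows "sum_top_blocks n (lie_bracket (four_block_mat X Y Y X) (four_block_mat X' Y' Y' X'))
    = lie_bracket (X + Y) (X' + Y')"
proof -
  have mult: "four_block_mat A B B A * four_block_mat A' B' B' A'
    = four_block_mat (A * A' + B * B') (A * B' + B * A') (B * A' + A * B') (B * B' + A * A')"
    if "A \<in> carrier_mat n n" "B \<in> carrier_mat n n" "A' \<in> carrier_mat n n" "B' \<in> carrier_mat n n"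
    for A B A' B' :: "complex mat"
    using that by (subst mult_four_block_mat[of _ n n _ n _ n _ _ n _ n]) simp_all
  have expand: "(A + B) * (A' + B') = A * A' + B * A' + (A * B' + B * B')"
    if "A \<in> carrier_mat n n" "B \<in> carrier_mat n n" "A' \<in> carrier_mat n n" "B' \<in> carrier_mat n n"
    for A B A' B' :: "complex mat"
    using that by (simp add: mult_add_distrib_mat[of _ n n _ n] add_mult_distrib_mat[of _ n n _ _ n])
  have regroup: "(P + Q - (P' + Q')) + (R + S - (R' + S')) = P + S + (R + Q) - (P' + S' + (R' + Q'))"
    if "P \<in> carrier_mat n n" "Q \<in> carrier_mat n n" "R \<in> carrier_mat n n" "S \<in> carrier_mat n n"
      "P' \<in> carrier_mat n n" "Q' \<in> carrier_mat n n" "R' \<in> carrier_mat n n" "S' \<in> carrier_mat n n"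
    for P Q R S P' Q' R' S' :: "complex mat"
    using that by (intro eq_matI) auto
  have diff[simp]: "A - B \<in> carrier_mat n n" if "B \<in> carrier_mat n n" for A B :: "complex mat"
    using that by (rule minus_carrier_mat)
  show ?thesis
    unfolding lie_bracket_def mult[OF c] mult[OF c(3,4,1,2)] expand[OF c] expand[OF c(3,4,1,2)]
    using c by (subst minus_four_block_mat[of _ n], simp_all,
        subst sum_top_blocks_four_block, simp_all, subst regroup, simp_all)
qed

lemma lie_iso_g0_gl: "lie_iso (2 * n) (g0 n) n (gl n) (sum_top_blocks n)"
proof (rule lie_iso_transport(1)[OF g0_lie_subalgebra, where g = "skew_sym_blocks n"])
  fix Z assume "Z \<in> g0 n"
  then obtain X Y where c: "X \<in> carrier_mat n n" "Y \<in> carrier_mat n n"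
    and t: "tilde n X = - X" "tilde n Y = Y" and Z: "Z = four_block_mat X Y Y X"
    by (rule g0_cases)
  have sum: "sum_top_blocks n Z = X + Y"
    unfolding Z by (rule sum_top_blocks_four_block[OF c c(2,1)])
  then show "sum_top_blocks n Z \<in> gl n" using c by (simp add: gl_def)
  \<comment> \<open>Here \<open>tilde n (X + Y)\<close> is \<open>- X + Y\<close>, so half the
    difference and half the sum with \<open>X + Y\<close> give back \<open>X\<close> and
    \<open>Y\<close>.\<close>
  have "(1/2) \<cdot>\<^sub>m (X + Y - tilde n (X + Y)) = X" "(1/2) \<cdot>\<^sub>m (X + Y + tilde n (X + Y)) = Y"
    unfolding tilde_add[OF c] t using c by (auto intro!: eq_matI)
  then show "skew_sym_blocks n (sum_top_blocks n Z) = Z"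
    unfolding sum skew_sym_blocks_def Let_def unfolding Z by (simp only:)
  show "sum_top_blocks n (k \<cdot>\<^sub>m Z) = k \<cdot>\<^sub>m sum_top_blocks n Z" for k
    unfolding sum unfolding Z smult_four_block_mat[OF c c(2,1)] using c
    by (simp add: sum_top_blocks_four_block add_smult_distrib_left_mat[of _ n n])
  fix Z' assume "Z' \<in> g0 n"
  then obtain X' Y' where c': "X' \<in> carrier_mat n n" "Y' \<in> carrier_mat n n"
    and Z': "Z' = four_block_mat X' Y' Y' X'"
    by (rule g0_cases)
  have sum': "sum_top_blocks n Z' = X' + Y'"
    unfolding Z' by (rule sum_top_blocks_four_block[OF c' c'(2,1)])
  have "sum_top_blocks n (Z + Z') = (X + X') + (Y + Y')"
    unfolding Z Z' using c c' add_four_block_mat[OF c c(2,1) c' c'(2,1)]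
    by (simp add: sum_top_blocks_four_block)
  also have "\<dots> = (X + Y) + (X' + Y')" using c c' by (intro eq_matI) auto
  finally show "sum_top_blocks n (Z + Z') = sum_top_blocks n Z + sum_top_blocks n Z'"
    by (simp only: sum sum')
  show "sum_top_blocks n (lie_bracket Z Z') = lie_bracket (sum_top_blocks n Z) (sum_top_blocks n Z')"
    unfolding sum sum' unfolding Z Z' by (rule sum_top_blocks_lie_bracket[OF c c'])
next
  fix M assume "M \<in> gl n"
  then have M: "M \<in> carrier_mat n n" by (simp add: gl_def)
  let ?X = "(1/2) \<cdot>\<^sub>m (M - tilde n M)" and ?Y = "(1/2) \<cdot>\<^sub>m (M + tilde n M)"
  have c: "?X \<in> carrier_mat n n" "?Y \<in> carrier_mat n n" using M by (auto intro!: carrier_matI)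
  have "tilde n ?X = - ?X" "tilde n ?Y = ?Y"
    using c M by (auto intro!: eq_matI simp: field_simps)
  then show "skew_sym_blocks n M \<in> g0 n"
    unfolding skew_sym_blocks_def Let_def g0_eq using c by blast
  show "sum_top_blocks n (skew_sym_blocks n M) = M"
    unfolding skew_sym_blocks_def Let_def sum_top_blocks_four_block[OF c c(2,1)]
    using M by (intro eq_matI) (auto simp: field_simps)
qed (simp add: gl_def)

section \<open>The splitting of the fixed point algebra\<close>

text \<open>Brackets of elements of \<open>V_part\<close> land in \<open>g0_tilde\<close>, so,
  unlike for \<open>g0_tilde\<close>, the subspace property is not taken from a Lie isomorphism but
  checked directly.\<close>

lemma V_part_subspace: "mat_subspace (2 * n) (V_part n)"
  unfolding mat_subspace_iff
proof (intro conjI ballI allI)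
  show "V_part n \<subseteq> carrier_mat (2 * n) (2 * n)"
    unfolding V_part_eq by (auto intro!: four_block_mat_carrier_double)
  show "0\<^sub>m (2 * n) (2 * n) \<in> V_part n"
    unfolding V_part_eq zero_eq_four_block_mat using tilde_zero[of n] zero_carrier_mat[of n n] by blast
next
  fix Z Z' assume "Z \<in> V_part n" "Z' \<in> V_part n"
  then obtain Y Y' where Y: "Y \<in> carrier_mat n n" "tilde n Y = Y" "Z = four_block_mat (0\<^sub>m n n) Y Y (0\<^sub>m n n)"
    and Y': "Y' \<in> carrier_mat n n" "tilde n Y' = Y'" "Z' = four_block_mat (0\<^sub>m n n) Y' Y' (0\<^sub>m n n)"
    unfolding V_part_eq by blast
  have "Z + Z' = four_block_mat (0\<^sub>m n n) (Y + Y') (Y + Y') (0\<^sub>m n n)"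
    unfolding Y(3) Y'(3) using Y(1) Y'(1) by (subst add_four_block_mat[of _ n n _ n _ n]) simp_all
  moreover have "Y + Y' \<in> carrier_mat n n" "tilde n (Y + Y') = Y + Y'"
    using Y(1,2) Y'(1,2) by (simp_all add: tilde_add)
  ultimately show "Z + Z' \<in> V_part n" unfolding V_part_eq by blast
next
  fix Z c assume "Z \<in> V_part n"
  then obtain Y where Y: "Y \<in> carrier_mat n n" "tilde n Y = Y" "Z = four_block_mat (0\<^sub>m n n) Y Y (0\<^sub>m n n)"
    unfolding V_part_eq by blast
  have "c \<cdot>\<^sub>m Z = four_block_mat (0\<^sub>m n n) (c \<cdot>\<^sub>m Y) (c \<cdot>\<^sub>m Y) (0\<^sub>m n n)"
    unfolding Y(3) using Y(1) by (subst smult_four_block_mat[of _ n n _ n _ n]) simp_all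
  moreover have "c \<cdot>\<^sub>m Y \<in> carrier_mat n n" "tilde n (c \<cdot>\<^sub>m Y) = c \<cdot>\<^sub>m Y"
    using Y(1,2) by (simp_all add: tilde_smult)
  ultimately show "c \<cdot>\<^sub>m Z \<in> V_part n" unfolding V_part_eq by blast
qed

lemma g0_tilde_subspace: "mat_subspace (2 * n) (g0_tilde n)"
  using lie_iso_so_g0_tilde(2)[of n] by (simp add: lie_iso_def lie_subalgebra_def)

lemma direct_sum_g0_tilde_V: "mat_direct_sum (2 * n) (g0 n) (g0_tilde n) (V_part n)"
proof (rule mat_direct_sumI[OF g0_subspace g0_tilde_subspace V_part_subspace])
  show "g0_tilde n \<subseteq> g0 n" "V_part n \<subseteq> g0 n" by (auto simp: g0_tilde_def V_part_def)
  show "\<exists>X\<in>g0_tilde n. \<exists>Y\<in>V_part n. Z = X + Y" if "Z \<in> g0 n" for Z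
  proof -
    obtain X Y where c: "X \<in> carrier_mat n n" "Y \<in> carrier_mat n n"
      and t: "tilde n X = - X" "tilde n Y = Y" and Z: "Z = four_block_mat X Y Y X"
      using \<open>Z \<in> g0 n\<close> by (rule g0_cases)
    have "Z = four_block_mat X (0\<^sub>m n n) (0\<^sub>m n n) X + four_block_mat (0\<^sub>m n n) Y Y (0\<^sub>m n n)"
      unfolding Z using c by (subst add_four_block_mat[of _ n n _ n _ n]) simp_all
    moreover have "four_block_mat X (0\<^sub>m n n) (0\<^sub>m n n) X \<in> g0_tilde n"
      unfolding g0_tilde_eq using c t by blast
    moreover have "four_block_mat (0\<^sub>m n n) Y Y (0\<^sub>m n n) \<in> V_part n"
      unfolding V_part_eq using c t by blast
    ultimately show ?thesis by blast
  qed
  show "g0_tilde n \<inter> V_part n \<subseteq> {0\<^sub>m (2 * n) (2 * n)}"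
  proof
    fix Z assume "Z \<in> g0_tilde n \<inter> V_part n"
    then obtain X Y where c: "X \<in> carrier_mat n n" "Y \<in> carrier_mat n n"
      and Z: "Z = four_block_mat X (0\<^sub>m n n) (0\<^sub>m n n) X" "Z = four_block_mat (0\<^sub>m n n) Y Y (0\<^sub>m n n)"
      unfolding g0_tilde_eq V_part_eq by blast
    then have "X = 0\<^sub>m n n"
      using four_block_mat_eq_iff[of X n "0\<^sub>m n n" "0\<^sub>m n n" X "0\<^sub>m n n" Y Y "0\<^sub>m n n"] by simp
    then show "Z \<in> {0\<^sub>m (2 * n) (2 * n)}" using Z(1) unfolding zero_eq_four_block_mat by blast
  qed
qed

section \<open>Dimensions by counting free entries\<close>

text \<open>Row \<open>i\<close> of the triangle has \<open>n - i\<close> positions. The factor 2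
  keeps the count free of division.\<close>

lemma card_triangle: "2 * card {(i, j). i + j < n} = n * (n + 1)" for n :: nat
proof -
  have "{(i, j). i + j < n} = (SIGMA i:{..<n}. {..<n - i})" by auto
  then have "card {(i, j). i + j < n} = (\<Sum>i<n. n - i)" by simp
  also have "2 * \<dots> = n * (n + 1)"
    \<comment> \<open>Splitting off the first summand instead of the last leaves exactly the sum for
      the smaller triangle.\<close>
    by (induction n) (simp_all add: sum.lessThan_Suc_shift algebra_simps del: sum.lessThan_Suc)
  finally show ?thesis by simp
qed

lemma finite_triangle: "finite {(i, j). i + j < n}" for n :: nat
  by (rule finite_subset[of _ "{..<n} \<times> {..<n}"]) auto

text \<open>\<open>tilde\<close> reflects a matrix in its anti-diagonal, which consists of the positions \<open>(i, j)\<close> with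
  \<open>i + j = n - 1\<close>. Its fixed points are given by the entries above and on the anti-diagonal, and
  its \<open>-1\<close> eigenvectors, which vanish on the anti-diagonal, by the entries above it.\<close>

lemma tilde_sym_eqI:
  assumes X: "X \<in> carrier_mat n n" "tilde n X = X" and Y: "Y \<in> carrier_mat n n" "tilde n Y = Y"
    and eq: "\<And>i j. i + j < n \<Longrightarrow> X $$ (i, j) = Y $$ (i, j)"
  shows "X = Y"
proof (rule eq_matI)
  fix i j assume "i < dim_row Y" "j < dim_col Y"
  then have ij: "i < n" "j < n" using Y by auto
  show "X $$ (i, j) = Y $$ (i, j)"
  proof (cases "i + j < n")
    case False
    \<comment> \<open>The mirror position has index sum \<open>2 * n - 2 - (i + j)\<close>, which is
      below \<open>n\<close> here, so the hypothesis applies to it.\<close>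
    have "X $$ (i, j) = X $$ (n - 1 - j, n - 1 - i)"
      using tilde_index[OF X(1) ij] unfolding X(2) .
    also have "\<dots> = Y $$ (n - 1 - j, n - 1 - i)" by (rule eq) (use False ij in auto)
    also have "\<dots> = Y $$ (i, j)"
      using tilde_index[OF Y(1) ij] unfolding Y(2) by simp
    finally show ?thesis .
  qed (rule eq)
qed (use X Y in auto)

lemma tilde_sym_exists:
  "\<exists>X \<in> carrier_mat n n. tilde n X = X \<and> (\<forall>i j. i + j < n \<longrightarrow> X $$ (i, j) = f (i, j))"
proof -
  \<comment> \<open>The prescribed entries are reflected to the other side of the
    anti-diagonal.\<close>
  let ?X = "mat n n (\<lambda>(i, j). if i + j < n then f (i, j) else f (n - 1 - j, n - 1 - i))"
  have "tilde n ?X = ?X"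
  proof (rule eq_matI)
    fix i j assume "i < dim_row ?X" "j < dim_col ?X"
    then have ij: "i < n" "j < n" by auto
    \<comment> \<open>A position and its mirror image both fall under the first case only on the
      anti-diagonal, where they coincide.\<close>
    moreover have "i + j + 1 = n" if "i + j < n" "n - 1 - j + (n - 1 - i) < n"
      using ij that by linarith
    moreover have "n - 1 - j = i \<and> n - 1 - i = j" if "i + j + 1 = n"
      using that by auto
    moreover have "n - 1 - j + (n - 1 - i) < n" if "\<not> i + j < n"
      using ij that by linarith
    ultimately show "tilde n ?X $$ (i, j) = ?X $$ (i, j)"
      by (cases "i + j < n"; cases "n - 1 - j + (n - 1 - i) < n") (auto simp: tilde_index)
  qed auto
  then show ?thesis by (intro bexI[of _ ?X]) auto
qed

lemma tilde_skew_eqI: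
  assumes X: "X \<in> carrier_mat n n" "tilde n X = - X" and Y: "Y \<in> carrier_mat n n" "tilde n Y = - Y"
    and eq: "\<And>i j. i + j < n - 1 \<Longrightarrow> X $$ (i, j) = Y $$ (i, j)"
  shows "X = Y"
proof (rule eq_matI)
  fix i j assume "i < dim_row Y" "j < dim_col Y"
  then have ij: "i < n" "j < n" using Y by auto
  have skew: "Z $$ (i, j) = - Z $$ (n - 1 - j, n - 1 - i)"
    if "Z \<in> carrier_mat n n" "tilde n Z = - Z" for Z
  proof -
    have "(- Z) $$ (i, j) = Z $$ (n - 1 - j, n - 1 - i)"
      using tilde_index[OF \<open>Z \<in> carrier_mat n n\<close> ij] unfolding \<open>tilde n Z = - Z\<close> .
    moreover have "(- Z) $$ (i, j) = - Z $$ (i, j)" using \<open>Z \<in> carrier_mat n n\<close> ij by simp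
    ultimately show ?thesis by (metis minus_minus)
  qed
  consider "i + j < n - 1" | "i + j = n - 1" | "n - 1 < i + j" by linarith
  then show "X $$ (i, j) = Y $$ (i, j)"
  proof cases
    \<comment> \<open>A position on the anti-diagonal is its own mirror image, so the entry equals
      its own negative and vanishes.\<close>
    case 2
    then have "n - 1 - j = i" "n - 1 - i = j" using ij by auto
    then show ?thesis using skew[OF X] skew[OF Y] by simp
  next
    case 3
    then have "X $$ (n - 1 - j, n - 1 - i) = Y $$ (n - 1 - j, n - 1 - i)"
      using ij by (intro eq) linarith
    then show ?thesis using skew[OF X] skew[OF Y] by simp
  qed (rule eq)
qed (use X Y in auto)

lemma tilde_skew_exists:
  "\<exists>X \<in> carrier_mat n n. tilde n X = - X \<and> (\<forall>i j. i + j < n - 1 \<longrightarrow> X $$ (i, j) = f (i, j))"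
proof -
  \<comment> \<open>The reflected entries change sign, and the anti-diagonal has to be filled with
    zeros.\<close>
  let ?g = "\<lambda>(i, j). if i + j < n - 1 then f (i, j)
    else if i + j = n - 1 then 0 else - f (n - 1 - j, n - 1 - i)"
  let ?X = "mat n n ?g"
  have "tilde n ?X = - ?X"
  proof (rule eq_matI)
    fix i j assume "i < dim_row (- ?X)" "j < dim_col (- ?X)"
    then have ij: "i < n" "j < n" by auto
    then have "?g (n - 1 - j, n - 1 - i) = - ?g (i, j)"
      using ij by (cases "i + j" "n - 1" rule: linorder_cases) auto
    then show "tilde n ?X $$ (i, j) = (- ?X) $$ (i, j)" using ij by simp
  qed auto
  then show ?thesis by (intro bexI[of _ ?X]) auto
qed

text \<open>The free entries lie strictly above the anti-diagonal of the top left block. They form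
  the triangle of size \<open>n - 1\<close>, and positivity of \<open>n\<close> turns
  \<open>n - 1 + 1\<close> into \<open>n\<close>.\<close>

lemma dim_g0_tilde:
  assumes "n > 0"
  shows "2 * mat_dim (2 * n) (g0_tilde n) = n * (n - 1)"
proof -
  let ?I = "{(i, j). i + j < n - 1}"
  have "mat_dim (2 * n) (g0_tilde n) = card ?I"
  proof (rule mat_dim_eq_card_entries[OF g0_tilde_subspace])
    show "?I \<subseteq> {..<2 * n} \<times> {..<2 * n}" by auto
    fix Z Z' assume "Z \<in> g0_tilde n" "Z' \<in> g0_tilde n" and eq: "\<And>p. p \<in> ?I \<Longrightarrow> Z $$ p = Z' $$ p"
    then obtain X X' where X: "X \<in> carrier_mat n n" "tilde n X = - X"
      and X': "X' \<in> carrier_mat n n" "tilde n X' = - X'"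
      and Z: "Z = four_block_mat X (0\<^sub>m n n) (0\<^sub>m n n) X" "Z' = four_block_mat X' (0\<^sub>m n n) (0\<^sub>m n n) X'"
      unfolding g0_tilde_eq by blast
    have "X = X'"
    proof (rule tilde_skew_eqI[OF X X'])
      fix i j assume "i + j < n - 1"
      moreover from this have "i < n" "j < n" by linarith+
      ultimately show "X $$ (i, j) = X' $$ (i, j)"
        using eq[of "(i, j)"] X(1) X'(1) unfolding Z by simp
    qed
    then show "Z = Z'" unfolding Z by simp
  next
    fix f
    obtain X where X: "X \<in> carrier_mat n n" "tilde n X = - X" "\<And>i j. i + j < n - 1 \<Longrightarrow> X $$ (i, j) = f (i, j)"
      using tilde_skew_exists[of n f] by blast
    then show "\<exists>Z\<in>g0_tilde n. \<forall>p\<in>?I. Z $$ p = f p"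
      by (intro bexI[of _ "four_block_mat X (0\<^sub>m n n) (0\<^sub>m n n) X"]) (auto simp: g0_tilde_eq)
  qed
  then show ?thesis using card_triangle[of "n - 1"] assms by (simp add: mult.commute)
qed

text \<open>The free entries form the triangle of size \<open>n\<close> in the top right block,
  hence the shift of the columns by \<open>n\<close>.\<close>

lemma dim_V_part: "2 * mat_dim (2 * n) (V_part n) = n * (n + 1)"
proof -
  let ?T = "{(i, j). i + j < n}" and ?s = "\<lambda>(i, j). (i, n + j)"
  have "mat_dim (2 * n) (V_part n) = card (?s ` ?T)"
  proof (rule mat_dim_eq_card_entries[OF V_part_subspace])
    show "?s ` ?T \<subseteq> {..<2 * n} \<times> {..<2 * n}" by auto
    fix Z Z' assume "Z \<in> V_part n" "Z' \<in> V_part n" and eq: "\<And>p. p \<in> ?s ` ?T \<Longrightarrow> Z $$ p = Z' $$ p"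
    then obtain Y Y' where Y: "Y \<in> carrier_mat n n" "tilde n Y = Y"
      and Y': "Y' \<in> carrier_mat n n" "tilde n Y' = Y'"
      and Z: "Z = four_block_mat (0\<^sub>m n n) Y Y (0\<^sub>m n n)" "Z' = four_block_mat (0\<^sub>m n n) Y' Y' (0\<^sub>m n n)"
      unfolding V_part_eq by blast
    have "Y = Y'"
    proof (rule tilde_sym_eqI[OF Y Y'])
      fix i j assume "i + j < n"
      then show "Y $$ (i, j) = Y' $$ (i, j)"
        using eq[of "(i, n + j)"] Y(1) Y'(1) unfolding Z by (simp add: image_iff)
    qed
    then show "Z = Z'" unfolding Z by simp
  next
    fix f
    obtain Y where Y: "Y \<in> carrier_mat n n" "tilde n Y = Y" "\<And>i j. i + j < n \<Longrightarrow> Y $$ (i, j) = f (i, n + j)"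
      using tilde_sym_exists[of n "\<lambda>p. f (?s p)"] by auto
    then show "\<exists>Z\<in>V_part n. \<forall>p\<in>?s ` ?T. Z $$ p = f p"
      by (intro bexI[of _ "four_block_mat (0\<^sub>m n n) Y Y (0\<^sub>m n n)"]) (auto simp: V_part_eq)
  qed
  also have "\<dots> = card ?T" by (intro card_image) (auto simp: inj_on_def)
  finally show ?thesis using card_triangle[of n] by simp
qed

text \<open>\<open>X\<close> and \<open>Y\<close> are independent \<open>tilde\<close>-symmetric
  blocks, so the free entries are two disjoint triangles of size \<open>n\<close>, one in each top
  block.\<close>

lemma dim_g1: "mat_dim (2 * n) (g1 n) = n * (n + 1)"
proof -
  let ?T = "{(i, j). i + j < n}" and ?s = "\<lambda>(i, j). (i, n + j)"
  have "mat_dim (2 * n) (g1 n) = card (?T \<union> ?s ` ?T)"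
  proof (rule mat_dim_eq_card_entries[OF g1_subspace])
    show "?T \<union> ?s ` ?T \<subseteq> {..<2 * n} \<times> {..<2 * n}" by auto
    fix Z Z' assume "Z \<in> g1 n" "Z' \<in> g1 n" and eq: "\<And>p. p \<in> ?T \<union> ?s ` ?T \<Longrightarrow> Z $$ p = Z' $$ p"
    then obtain X Y X' Y' where X: "X \<in> carrier_mat n n" "tilde n X = X"
      and Y: "Y \<in> carrier_mat n n" "tilde n Y = Y"
      and X': "X' \<in> carrier_mat n n" "tilde n X' = X'"
      and Y': "Y' \<in> carrier_mat n n" "tilde n Y' = Y'"
      and Z: "Z = four_block_mat X Y (- Y) (- X)" "Z' = four_block_mat X' Y' (- Y') (- X')"
      unfolding g1_eq by blast
    have "X = X'"
    proof (rule tilde_sym_eqI[OF X X'])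
      fix i j assume "i + j < n"
      then show "X $$ (i, j) = X' $$ (i, j)"
        using eq[of "(i, j)"] X(1) X'(1) unfolding Z by simp
    qed
    moreover have "Y = Y'"
    proof (rule tilde_sym_eqI[OF Y Y'])
      fix i j assume "i + j < n"
      then show "Y $$ (i, j) = Y' $$ (i, j)"
        using eq[of "(i, n + j)"] X(1) X'(1) Y(1) Y'(1) unfolding Z by (simp add: image_iff)
    qed
    ultimately show "Z = Z'" unfolding Z by simp
  next
    fix f
    obtain X where X: "X \<in> carrier_mat n n" "tilde n X = X" "\<And>i j. i + j < n \<Longrightarrow> X $$ (i, j) = f (i, j)"
      using tilde_sym_exists[of n f] by blast
    obtain Y where Y: "Y \<in> carrier_mat n n" "tilde n Y = Y" "\<And>i j. i + j < n \<Longrightarrow> Y $$ (i, j) = f (i, n + j)"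
      using tilde_sym_exists[of n "\<lambda>p. f (?s p)"] by auto
    have "four_block_mat X Y (- Y) (- X) \<in> g1 n"
      unfolding g1_eq using X(1,2) Y(1,2) by blast
    moreover have "\<forall>p\<in>?T \<union> ?s ` ?T. four_block_mat X Y (- Y) (- X) $$ p = f p"
      using X(1,3) Y(1,3) by auto
    ultimately show "\<exists>Z\<in>g1 n. \<forall>p\<in>?T \<union> ?s ` ?T. Z $$ p = f p" by blast
  qed
  also have "\<dots> = card ?T + card (?s ` ?T)"
    by (intro card_Un_disjoint finite_imageI finite_triangle) auto
  also have "card (?s ` ?T) = card ?T" by (intro card_image) (auto simp: inj_on_def)
  finally show ?thesis using card_triangle[of n] by simp
qed

theorem mainTheorem4:
  fixes n :: nat
  assumes "n \<ge> 2"
  shows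
    "lie_isomorphic (2 * n) (g_alg n) (2 * n) (sp n) \<and>
     lie_iso (2 * n) (g_alg n) (2 * n) (g_alg n) (lam n) \<and>
     (\<forall>Z \<in> g_alg n. lam n (lam n Z) = Z) \<and>
     mat_direct_sum (2 * n) (g_alg n) (g0 n) (g1 n) \<and>
     g0 n = {four_block_mat X Y Y X | X Y.
       X \<in> carrier_mat n n \<and> Y \<in> carrier_mat n n \<and> tilde n X = - X \<and> tilde n Y = Y} \<and>
     g1 n = {four_block_mat X Y (- Y) (- X) | X Y.
       X \<in> carrier_mat n n \<and> Y \<in> carrier_mat n n \<and> tilde n X = X \<and> tilde n Y = Y} \<and>
     mat_direct_sum (2 * n) (g0 n) (g0_tilde n) (V_part n) \<and>
     lie_isomorphic (2 * n) (g0_tilde n) n (so n) \<and>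
     lie_isomorphic (2 * n) (g0 n) n (gl n) \<and>
     real (mat_dim (2 * n) (g0_tilde n)) = 1 / 2 * real n * (real n - 1) \<and>
     real (mat_dim (2 * n) (V_part n)) = 1 / 2 * real n * (real n + 1) \<and>
     mat_dim (2 * n) (g1 n) = n * (n + 1)"
proof (intro conjI)
  show "lie_isomorphic (2 * n) (g_alg n) (2 * n) (sp n)"
    unfolding lie_isomorphic_def using lie_iso_sp_g_alg(2) by blast
  show "lie_isomorphic (2 * n) (g0_tilde n) n (so n)"
    unfolding lie_isomorphic_def using lie_iso_so_g0_tilde(2) by blast
  show "lie_isomorphic (2 * n) (g0 n) n (gl n)"
    unfolding lie_isomorphic_def using lie_iso_g0_gl by blast
  \<comment> \<open>The doubled identity over the naturals is moved to the reals, where halving is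
    exact; \<open>n \<ge> 2\<close> justifies the cast of \<open>n - 1\<close>.\<close>
  have "real (2 * mat_dim (2 * n) (g0_tilde n)) = real (n * (n - 1))"
    using dim_g0_tilde[of n] assms by simp
  then show "real (mat_dim (2 * n) (g0_tilde n)) = 1 / 2 * real n * (real n - 1)"
    using assms by (simp add: of_nat_diff)
  have "real (2 * mat_dim (2 * n) (V_part n)) = real (n * (n + 1))"
    using dim_V_part[of n] by simp
  then show "real (mat_dim (2 * n) (V_part n)) = 1 / 2 * real n * (real n + 1)"
    by (simp add: algebra_simps)
qed (use lie_iso_lam lam_lam direct_sum_g0_g1 direct_sum_g0_tilde_V dim_g1 in \<open>simp_all add: g0_eq g1_eq\<close>)

end
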